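(* Let $\mathcal{A}$ be a $C^*$-algebra with unit $e$. (i) If $a\in\mathcal{A}$ is an isometry (that is, $a^*a=e$), then $a\perp_R e$ if and only if $V(a)=-V(a)$. (ii) If $a\in\mathcal{A}$ is normal, then $a\perp_R e$ if and only if $V(a)=-V(a)$. (iii) If $a\in\mathcal{A}$ is self-adjoint, then $a\perp_R e$ if and only if both $\|a\|\in\sigma(a)$ and $-\|a\|\in\sigma(a)$.
   Context: $C^*$-algebras are complex. For elements $x,y$ of a complex normed linear space, $x$ is Roberts orthogonal to $y$, written $x\perp_R y$, if $\|x+\lambda y\|=\|x-\lambda y\|$ for all $\lambda\in\mathbb{C}$. $S(\mathcal{A})$ denotes the set of states of $\mathcal{A}$, i.e. positive linear functionals on $\mathcal{A}$ of norm $1$. The numerical range of $a\in\mathcal{A}$ is $V(a)=\{\varphi(a):\varphi\in S(\mathcal{A})\}\subseteq\mathbb{C}$, and $-V(a)=\{-z: z\in V(a)\}$. $\sigma(a)$ denotes the spectrum of $a$. *)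

theory Defs
  imports "HOL-Analysis.Analysis"
begin

class complex_normed_vector = real_normed_vector +
  fixes scaleC :: "complex \<Rightarrow> 'a \<Rightarrow> 'a"  (infixr "*\<^sub>C" 75)
  assumes scaleC_add_right: "c *\<^sub>C (x + y) = c *\<^sub>C x + c *\<^sub>C y"
    and scaleC_add_left: "(c + d) *\<^sub>C x = c *\<^sub>C x + d *\<^sub>C x"
    and scaleC_scaleC: "c *\<^sub>C (d *\<^sub>C x) = (c * d) *\<^sub>C x"
    and scaleC_of_real: "complex_of_real r *\<^sub>C x = r *\<^sub>R x"
    and norm_scaleC: "norm (c *\<^sub>C x) = cmod c * norm x"

text \<open>The class \<^class>\<open>real_normed_algebra_1\<close> includes \<^prop>\<open>(0::'a::zero_neq_one) \<noteq> 1\<close>,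
  so the zero algebra is excluded; its axiom \<open>norm 1 = 1\<close> is then a consequence of the
  \<open>C*\<close>-identity and costs no generality.\<close>

class unital_cstar_algebra = complex_normed_vector + real_normed_algebra_1 + banach +
  fixes star :: "'a \<Rightarrow> 'a"
  assumes mult_scaleC_left: "(c *\<^sub>C x) * y = c *\<^sub>C (x * y)"
    and mult_scaleC_right: "x * (c *\<^sub>C y) = c *\<^sub>C (x * y)"
    and star_star: "star (star x) = x"
    and star_add: "star (x + y) = star x + star y"
    and star_scaleC: "star (c *\<^sub>C x) = cnj c *\<^sub>C star x"
    and star_mult: "star (x * y) = star y * star x"
    and cstar_identity: "norm (star x * x) = (norm x)\<^sup>2"

definition roberts_orthogonal :: "'a::complex_normed_vector \<Rightarrow> 'a \<Rightarrow> bool"  (infix "\<bottom>\<^sub>R" 50)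
  where "x \<bottom>\<^sub>R y \<longleftrightarrow> (\<forall>c. norm (x + c *\<^sub>C y) = norm (x - c *\<^sub>C y))"

text \<open>Boundedness is required explicitly because \<^const>\<open>onorm\<close> is a supremum that is
  meaningful only for bounded maps; \<^const>\<open>bounded_linear\<close> itself is only real-linear.\<close>

definition states :: "('a::unital_cstar_algebra \<Rightarrow> complex) set"
  where "states = {\<phi>. bounded_linear \<phi> \<and> (\<forall>c x. \<phi> (c *\<^sub>C x) = c * \<phi> x) \<and>
    (\<forall>x. \<phi> (star x * x) \<in> \<real>\<^sub>\<ge>\<^sub>0) \<and> onorm \<phi> = 1}"

definition numerical_range :: "'a::unital_cstar_algebra \<Rightarrow> complex set"
  where "numerical_range a = {\<phi> a |\<phi>. \<phi> \<in> states}"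

definition spectrum :: "'a::unital_cstar_algebra \<Rightarrow> complex set"
  where "spectrum a =
    {z. \<not> (\<exists>b. (a - z *\<^sub>C 1) * b = 1 \<and> b * (a - z *\<^sub>C 1) = 1)}"

end

theory Submission
  imports Defs
begin

text \<open>The key is that the numerical range is an intersection of discs,
  \<open>V(a) = {z. \<forall>c. |z + c| \<le> \<parallel>a + c\<parallel>}\<close> (\<open>numerical_range_iff\<close>). Since \<open>a \<bottom>\<^sub>R 1\<close>
  says exactly that \<open>\<parallel>a + c\<parallel> = \<parallel>a - c\<parallel>\<close> for all \<open>c\<close>, it makes this family of discs invariant
  under \<open>z \<mapsto> -z\<close>, and so \<open>V(a) = -V(a)\<close> for every \<open>a\<close>. The nontrivial inclusion
  comes from the Hahn-Banach theorem, which yields a contractive functional with value \<open>1\<close> at the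
  unit and \<open>z\<close> at \<open>a\<close>, and from the fact that such a functional is positive.

  For the converse, \<open>\<parallel>a + c\<parallel>\<close> has to be recovered from values of states. If \<open>p\<close> is positive then
  \<open>\<parallel>p\<parallel>\<close> is in the spectrum of \<open>p\<close> (\<open>norm_minus_positive_not_invertible\<close>), and
  the spectrum lies in the numerical range. For an isometry this is applied to
  \<open>p = (a + c)\<^sup>*(a + c) = 1 + |c|\<^sup>2 + 2 Re (cnj c a)\<close>, which is affine in \<open>a\<close> and \<open>a\<^sup>*\<close>, so that its
  value at a state depends on the value at \<open>a\<close> only. For a normal element \<open>b = a + c\<close>
  the norm is the numerical radius \<open>w(b)\<close>: always \<open>w(b\<^sup>2) \<le> w(b)\<^sup>2\<close> and \<open>\<parallel>b\<parallel> \<le> 2 w(b)\<close>, while normality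
  gives \<open>\<parallel>b\<parallel>\<close> to the power \<open>2^n\<close> as the norm of the \<open>2^n\<close>-th power of \<open>b\<close>; taking roots
  removes the factor \<open>2\<close> (\<open>normal_norm_le_numerical_radius\<close>).

  For self-adjoint \<open>a\<close>, one of \<open>\<plusminus>\<parallel>a\<parallel>\<close> is in the spectrum. If it is \<open>\<parallel>a\<parallel>\<close>, orthogonality gives
  \<open>\<parallel>a - \<parallel>a\<parallel>\<parallel> = \<parallel>a + \<parallel>a\<parallel>\<parallel> = 2\<parallel>a\<parallel>\<close>, and the positive element \<open>\<parallel>a\<parallel> - a\<close> then has its norm \<open>2\<parallel>a\<parallel>\<close>
  in its spectrum, that is, \<open>-\<parallel>a\<parallel>\<close> is in the spectrum of \<open>a\<close>. Conversely, if both are in the spectrum,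
  \<open>\<parallel>a + c\<parallel>\<^sup>2 = (\<parallel>a\<parallel> + |Re c|)\<^sup>2 + (Im c)\<^sup>2\<close>, which is even in \<open>c\<close>.

  The order structure is developed without Gelfand theory. The two tools are the binomial
  series for \<open>sqrt (1 - k)\<close>, which converges on the closed unit ball, and the unitary \<open>h + i sqrt (1 - h\<^sup>2)\<close>
  attached to a self-adjoint contraction \<open>h\<close>.\<close>

section \<open>Scalars and the involution\<close>

lemma scaleC_one [simp]: "1 *\<^sub>C (x::'a::complex_normed_vector) = x"
  using scaleC_of_real[of 1 x] by simp

lemma scaleC_zero_left [simp]: "0 *\<^sub>C (x::'a::complex_normed_vector) = 0"
  using scaleC_of_real[of 0 x] by simp

lemma scaleC_zero_right [simp]: "c *\<^sub>C (0::'a::complex_normed_vector) = 0"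
  using scaleC_add_right[of c 0 "0::'a"] by simp

lemma scaleC_minus_left [simp]: "(- c) *\<^sub>C (x::'a::complex_normed_vector) = - (c *\<^sub>C x)"
  using scaleC_add_left[of c "-c" x] by (simp add: eq_neg_iff_add_eq_0 add.commute)

lemma scaleC_minus_right [simp]: "c *\<^sub>C (- x) = - (c *\<^sub>C (x::'a::complex_normed_vector))"
  using scaleC_add_right[of c x "-x"] by (simp add: eq_neg_iff_add_eq_0 add.commute)

lemma scaleC_diff_right: "c *\<^sub>C (x - y) = c *\<^sub>C x - c *\<^sub>C (y::'a::complex_normed_vector)"
  using scaleC_add_right[of c x "-y"] by simp

lemma scaleC_scaleR: "c *\<^sub>C (r *\<^sub>R x) = (c * of_real r) *\<^sub>C (x::'a::complex_normed_vector)"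
  by (simp add: scaleC_of_real[symmetric] scaleC_scaleC)

lemma scaleR_scaleC: "r *\<^sub>R (c *\<^sub>C x) = (of_real r * c) *\<^sub>C (x::'a::complex_normed_vector)"
  by (simp add: scaleC_of_real[symmetric] scaleC_scaleC)

lemmas scaleC_simps = scaleC_add_right scaleC_diff_right mult_scaleC_left mult_scaleC_right
  scaleC_scaleC

lemma star_zero [simp]: "star (0::'a::unital_cstar_algebra) = 0"
  using star_add[of 0 "0::'a"] by simp

lemma star_minus [simp]: "star (- x) = - star (x::'a::unital_cstar_algebra)"
  using star_add[of x "-x"] by (simp add: eq_neg_iff_add_eq_0 add.commute)

lemma star_diff: "star (x - y) = star x - star (y::'a::unital_cstar_algebra)"
  using star_add[of x "-y"] by simp

lemma star_scaleR [simp]: "star (r *\<^sub>R x) = r *\<^sub>R star (x::'a::unital_cstar_algebra)"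
  by (metis scaleC_of_real star_scaleC complex_cnj_complex_of_real)

lemma star_one [simp]: "star (1::'a::unital_cstar_algebra) = 1"
  by (metis mult_1_right mult_1_left star_mult star_star)

lemma star_power: "star (x ^ n) = star (x::'a::unital_cstar_algebra) ^ n"
  by (induction n) (simp_all add: star_mult power_commutes)

lemma norm_star [simp]: "norm (star x) = norm (x::'a::unital_cstar_algebra)"
proof -
  have le: "norm y \<le> norm (star y)" for y :: 'a
  proof (cases "y = 0")
    case False
    have "norm y * norm y \<le> norm (star y) * norm y"
      using cstar_identity[of y] norm_mult_ineq[of "star y" y] by (simp add: power2_eq_square)
    with False show ?thesis by simp
  qed simp
  show ?thesis using le[of x] le[of "star x"] by (simp add: star_star)
qed

lemma norm_square_selfadjoint:
  fixes h :: "'a::unital_cstar_algebra"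
  assumes "star h = h"
  shows "norm (h * h) = (norm h)\<^sup>2"
  using cstar_identity[of h] assms by simp

lemma bounded_linear_star: "bounded_linear (star :: 'a::unital_cstar_algebra \<Rightarrow> 'a)"
  by (rule bounded_linear_intro[where K=1]) (simp_all add: star_add)

section \<open>Square roots and positive elements\<close>

text \<open>The coefficients of the binomial series of \<open>sqrt (1 - x)\<close>. All but the first are nonpositive and
  all partial sums are nonnegative, so their absolute values are summable. This is why the
  series converges on the closed unit ball and not only inside it.\<close>

definition sqrt_coeff :: "nat \<Rightarrow> real"
  where "sqrt_coeff n = (-1) ^ n * ((1/2) gchoose n)"

lemma sqrt_coeff_0 [simp]: "sqrt_coeff 0 = 1"
  by (simp add: sqrt_coeff_def)

lemma alternating_gbinomial_Suc:
  fixes a :: real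
  shows "(-1) ^ Suc n * (a gchoose Suc n) = ((-1) ^ n * (a gchoose n)) * ((n - a) / (n + 1))"
proof -
  have "(a gchoose Suc n) = (a gchoose n) * ((a - n) / (n + 1))"
    using gbinomial_mult_1[of a n] by (simp add: field_simps)
  then show ?thesis
    by (simp add: algebra_simps)
qed

text \<open>A partial sum of the coefficients of \<open>sqrt (1 - x)\<close> is a coefficient of
  \<open>sqrt (1 - x) / (1 - x)\<close>, that is, of the series of \<open>(1 - x)\<close> to the power \<open>-1/2\<close>, whose
  coefficients are all positive.\<close>

lemma sum_sqrt_coeff_nonneg: "0 \<le> (\<Sum>k\<le>n. sqrt_coeff k)"
proof -
  have nn: "0 \<le> (-1) ^ n * ((-1/2::real) gchoose n)" 
  proof (induction n)
    case (Suc n)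
    show ?case
      unfolding alternating_gbinomial_Suc using Suc by (rule mult_nonneg_nonneg) simp
  qed simp
  have "(\<Sum>k\<le>n. sqrt_coeff k) = (\<Sum>k\<le>n. ((1/2::real) gchoose k) * (-1) ^ k)"
    by (simp add: sqrt_coeff_def mult.commute)
  also have "\<dots> = (-1) ^ n * ((1/2 - 1::real) gchoose n)"
    by (rule gbinomial_sum_lower_neg)
  finally show ?thesis using nn by simp
qed

lemma sqrt_coeff_Suc_nonpos: "sqrt_coeff (Suc n) \<le> 0"
proof (induction n)
  case 0 show ?case by (simp add: sqrt_coeff_def)
next
  case (Suc n)
  have "sqrt_coeff (Suc (Suc n)) = sqrt_coeff (Suc n) * ((n + 1/2) / (n + 2))"
    using alternating_gbinomial_Suc[of "Suc n" "1/2"] by (simp add: sqrt_coeff_def add_ac)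
  moreover have "0 \<le> (n + 1/2) / (real n + 2)" by simp
  ultimately show ?case using Suc by (simp add: mult_nonpos_nonneg divide_nonpos_nonneg)
qed

lemma sum_abs_sqrt_coeff: "(\<Sum>k<n. \<bar>sqrt_coeff (Suc k)\<bar>) \<le> 1"
proof -
  have "(\<Sum>k<n. \<bar>sqrt_coeff (Suc k)\<bar>) = - (\<Sum>k<n. sqrt_coeff (Suc k))"
    by (simp add: sqrt_coeff_Suc_nonpos sum_negf)
  moreover have "(\<Sum>k\<le>n. sqrt_coeff k) = 1 + (\<Sum>k<n. sqrt_coeff (Suc k))"
    by (simp add: sum.atMost_shift)
  ultimately show ?thesis using sum_sqrt_coeff_nonneg[of n] by linarith
qed

lemma summable_abs_sqrt_coeff: "summable (\<lambda>n. \<bar>sqrt_coeff n\<bar>)"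
  and suminf_abs_sqrt_coeff: "(\<Sum>n. \<bar>sqrt_coeff (Suc n)\<bar>) \<le> 1"
proof -
  have s: "summable (\<lambda>n. \<bar>sqrt_coeff (Suc n)\<bar>)"
    by (rule summableI_nonneg_bounded[where x=1]) (auto simp: sum_abs_sqrt_coeff)
  show "summable (\<lambda>n. \<bar>sqrt_coeff n\<bar>)"
    using s by (subst (asm) summable_Suc_iff)
  show "(\<Sum>n. \<bar>sqrt_coeff (Suc n)\<bar>) \<le> 1"
    by (rule suminf_le_const[OF s]) (rule sum_abs_sqrt_coeff)
qed

text \<open>The square of the series is \<open>1 - x\<close>: Vandermonde's identity for \<open>1/2 + 1/2 = 1\<close>.\<close>

lemma sqrt_coeff_convolution:
  "(\<Sum>i\<le>n. sqrt_coeff i * sqrt_coeff (n - i)) = (if n = 0 then 1 else if n = 1 then -1 else 0)"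
proof -
  have "(\<Sum>i\<le>n. sqrt_coeff i * sqrt_coeff (n - i))
    = (\<Sum>i\<le>n. (-1)^n * (((1/2) gchoose i) * ((1/2) gchoose (n - i))))"
  proof (rule sum.cong)
    fix i assume "i \<in> {..n}"
    then have "(-1::real)^n = (-1)^i * (-1)^(n-i)" by (simp flip: power_add)
    then show "sqrt_coeff i * sqrt_coeff (n - i) = (-1)^n * (((1/2) gchoose i) * ((1/2) gchoose (n - i)))"
      by (simp add: sqrt_coeff_def)
  qed simp
  also have "\<dots> = (-1)^n * ((1::real) gchoose n)"
    using gbinomial_Vandermonde[of "1/2::real" "1/2" n]
    by (simp add: sum_distrib_left[symmetric] atLeast0AtMost)
  also have "((1::real) gchoose n) = of_nat (1 choose n)"
    using binomial_gbinomial[of 1 n, where ?'a=real] by simp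
  also have "(-1)^n * real (1 choose n) = (if n = 0 then 1 else if n = 1 then -1 else 0)"
    by (cases n; cases "n - 1") auto
  finally show ?thesis .
qed

definition sqrt_one_minus :: "'a::unital_cstar_algebra \<Rightarrow> 'a"
  where "sqrt_one_minus k = (\<Sum>n. sqrt_coeff n *\<^sub>R k ^ n)"

context
  fixes k :: "'a::unital_cstar_algebra"
  assumes k: "norm k \<le> 1"
begin

lemma sqrt_series_term_bound: "norm (sqrt_coeff n *\<^sub>R k ^ n) \<le> \<bar>sqrt_coeff n\<bar>"
proof -
  have "norm (k ^ n) \<le> norm k ^ n" by (rule norm_power_ineq)
  also have "\<dots> \<le> 1" using k by (simp add: power_le_one)
  finally show ?thesis by (simp add: mult_left_le)
qed

lemma summable_norm_sqrt_series: "summable (\<lambda>n. norm (sqrt_coeff n *\<^sub>R k ^ n))"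
  by (rule summable_comparison_test'[OF summable_abs_sqrt_coeff, of 0])
    (use sqrt_series_term_bound in simp)

lemma summable_sqrt_series: "summable (\<lambda>n. sqrt_coeff n *\<^sub>R k ^ n)"
  by (rule summable_norm_cancel[OF summable_norm_sqrt_series])

lemma sqrt_one_minus_square: "sqrt_one_minus k * sqrt_one_minus k = 1 - k"
proof -
  let ?t = "\<lambda>n. sqrt_coeff n *\<^sub>R k ^ n"
  have "(\<lambda>n. \<Sum>i\<le>n. ?t i * ?t (n - i)) sums (sqrt_one_minus k * sqrt_one_minus k)"
    unfolding sqrt_one_minus_def
    by (rule Cauchy_product_sums[OF summable_norm_sqrt_series summable_norm_sqrt_series])
  moreover have "(\<Sum>i\<le>n. ?t i * ?t (n - i)) = (if n = 0 then 1 else if n = 1 then -1 else 0) *\<^sub>R k ^ n" for n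
  proof -
    have "(\<Sum>i\<le>n. ?t i * ?t (n - i)) = (\<Sum>i\<le>n. (sqrt_coeff i * sqrt_coeff (n - i)) *\<^sub>R k ^ n)"
      by (rule sum.cong) (simp_all flip: power_add)
    also have "\<dots> = (\<Sum>i\<le>n. sqrt_coeff i * sqrt_coeff (n - i)) *\<^sub>R k ^ n"
      by (simp add: scaleR_sum_left)
    finally show ?thesis by (simp only: sqrt_coeff_convolution)
  qed
  ultimately have "(\<lambda>n. (if n = 0 then 1 else if n = 1 then -1 else 0) *\<^sub>R k ^ n) sums (sqrt_one_minus k * sqrt_one_minus k)"
    by simp
  moreover have "(\<lambda>n. (if n = 0 then 1 else if n = 1 then -1 else 0) *\<^sub>R k ^ n) sums
    (\<Sum>n<2. (if n = 0 then 1 else if n = 1 then -1 else 0) *\<^sub>R k ^ n)"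
    by (rule sums_finite) auto
  ultimately show ?thesis
    by (auto dest: sums_unique2 simp: numeral_2_eq_2)
qed

lemma sqrt_one_minus_near_one: "norm (1 - sqrt_one_minus k) \<le> 1"
proof -
  have "sqrt_one_minus k = 1 + (\<Sum>n. sqrt_coeff (Suc n) *\<^sub>R k ^ Suc n)"
    unfolding sqrt_one_minus_def using suminf_split_head[OF summable_sqrt_series] by simp
  then have "norm (1 - sqrt_one_minus k) = norm (\<Sum>n. sqrt_coeff (Suc n) *\<^sub>R k ^ Suc n)"
    by simp
  also have "\<dots> \<le> (\<Sum>n. norm (sqrt_coeff (Suc n) *\<^sub>R k ^ Suc n))"
    using summable_norm_sqrt_series[THEN summable_ignore_initial_segment, of 1]
    by (intro summable_norm) (simp only: Suc_eq_plus1)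
  also have "\<dots> \<le> (\<Sum>n. \<bar>sqrt_coeff (Suc n)\<bar>)"
    using summable_norm_sqrt_series[THEN summable_ignore_initial_segment, of 1]
      summable_abs_sqrt_coeff[THEN summable_ignore_initial_segment, of 1]
    by (intro suminf_le sqrt_series_term_bound) (simp_all only: Suc_eq_plus1)
  also have "\<dots> \<le> 1" by (rule suminf_abs_sqrt_coeff)
  finally show ?thesis .
qed

lemma sqrt_one_minus_commute:
  assumes "x * k = k * x"
  shows "x * sqrt_one_minus k = sqrt_one_minus k * x"
proof -
  have "x * k ^ n = k ^ n * x" for n
    using assms by (metis power_commuting_commutes)
  then show ?thesis
    unfolding sqrt_one_minus_def
    by (simp add: suminf_mult[OF summable_sqrt_series, symmetric]
        suminf_mult2[OF summable_sqrt_series])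
qed

lemma star_sqrt_one_minus:
  assumes "star k = k"
  shows "star (sqrt_one_minus k) = sqrt_one_minus k"
  unfolding sqrt_one_minus_def
  by (simp add: bounded_linear.suminf[OF bounded_linear_star summable_sqrt_series] star_power assms)

end

text \<open>Positivity is a norm condition: the spectrum of a self-adjoint \<open>p\<close> is nonnegative iff it lies in a
  disc with centre \<open>c\<close> and radius \<open>c\<close>. With this definition sums of positive elements are
  positive by the triangle inequality, and \<open>positive_sqrt\<close> and \<open>positive_square\<close> identify the
  positive elements with the squares of self-adjoint ones.\<close>

definition positive :: "'a::unital_cstar_algebra \<Rightarrow> bool"
  where "positive p \<longleftrightarrow> star p = p \<and> (\<exists>c. norm (c *\<^sub>R 1 - p) \<le> c)"

lemma positive_selfadjoint: "positive p \<Longrightarrow> star p = p"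
  by (simp add: positive_def)

lemma star_square_selfadjoint:
  fixes h :: "'a::unital_cstar_algebra"
  shows "star h = h \<Longrightarrow> star (h * h) = h * h"
  by (simp add: star_mult)

lemma positive_add:
  assumes "positive p" "positive q"
  shows "positive (p + q)"
proof -
  obtain c d where cd: "norm (c *\<^sub>R 1 - p) \<le> c" "norm (d *\<^sub>R 1 - q) \<le> d"
    using assms by (auto simp: positive_def)
  have "norm ((c + d) *\<^sub>R 1 - (p + q)) = norm ((c *\<^sub>R 1 - p) + (d *\<^sub>R 1 - q))"
    by (simp add: algebra_simps)
  also have "\<dots> \<le> c + d" using cd by (intro norm_triangle_le) simp
  finally show ?thesis using assms by (auto simp: positive_def star_add)
qed

lemma positive_scaleR:
  assumes "positive p" "0 \<le> t"
  shows "positive (t *\<^sub>R p)"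
proof -
  obtain c where c: "norm (c *\<^sub>R 1 - p) \<le> c"
    using assms by (auto simp: positive_def)
  have "norm ((t * c) *\<^sub>R 1 - t *\<^sub>R p) = norm (t *\<^sub>R (c *\<^sub>R 1 - p))"
    by (simp add: algebra_simps)
  also have "\<dots> \<le> t * c" using c assms(2) by (simp add: mult_left_mono)
  finally show ?thesis using assms by (auto simp: positive_def)
qed

lemma positive_real_minus:
  fixes x :: "'a::unital_cstar_algebra"
  assumes "star x = x" "norm x \<le> r"
  shows "positive (r *\<^sub>R 1 - x)"
  using assms by (auto simp: positive_def star_diff intro!: exI[of _ r])

text \<open>For commuting self-adjoint \<open>x\<close> and \<open>y\<close> the element \<open>u = x + i y\<close> satisfies \<open>u\<^sup>* u = x\<^sup>2 + y\<^sup>2\<close>. If this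
  is a scalar, the \<open>C*\<close>-identity gives the norm of \<open>u\<close>, and \<open>x\<close> is the real part of \<open>u\<close>.\<close>

lemma norm_real_combination_le:
  fixes x y :: "'a::unital_cstar_algebra"
  assumes "star x = x" "star y = y" "x * y = y * x" "x * x + y * y = r *\<^sub>R 1" "0 \<le> r"
  shows "norm (x + \<i> *\<^sub>C y) = sqrt r" "norm x \<le> sqrt r"
proof -
  let ?u = "x + \<i> *\<^sub>C y"
  have su: "star ?u = x - \<i> *\<^sub>C y"
    using assms by (simp add: star_add star_scaleC)
  have "star ?u * ?u = x * x + y * y"
    unfolding su using assms(3)
    by (simp add: algebra_simps scaleC_simps)
  then have "(norm ?u)\<^sup>2 = r"
    using cstar_identity[of ?u] assms by simp
  then show u: "norm ?u = sqrt r" by (metis norm_ge_zero real_sqrt_abs abs_of_nonneg)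
  have "2 *\<^sub>R x = ?u + star ?u" unfolding su by (simp add: scaleR_2)
  then have "norm (2 *\<^sub>R x) \<le> norm ?u + norm (star ?u)" by (metis norm_triangle_ineq)
  with u show "norm x \<le> sqrt r" by simp
qed

text \<open>With \<open>s = sqrt (1 - h\<^sup>2)\<close>, the unitary \<open>u = h + i s\<close> plays the role of \<open>exp (i t)\<close> for \<open>h = cos t\<close>, and
  \<open>2 h\<^sup>2 - 1\<close> is the real part of \<open>u\<^sup>2\<close> by the double angle formula.\<close>

lemma norm_one_minus_two_squares:
  fixes h :: "'a::unital_cstar_algebra"
  assumes "star h = h" "norm h \<le> 1"
  shows "norm (1 - 2 *\<^sub>R (h * h)) \<le> 1"
proof -
  define s where "s = sqrt_one_minus (h * h)"
  have hh: "norm (h * h) \<le> 1"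
    using assms by (simp add: norm_square_selfadjoint power_le_one)
  have s: "s * s = 1 - h * h" "h * s = s * h" "star s = s"
    unfolding s_def
    using hh assms by (auto simp: sqrt_one_minus_square star_square_selfadjoint mult.assoc
        intro!: sqrt_one_minus_commute star_sqrt_one_minus)
  define u where "u = h + \<i> *\<^sub>C s"
  have nu: "norm u = 1"
    unfolding u_def using norm_real_combination_le(1)[of h s 1] s assms by simp
  have su: "star u = h - \<i> *\<^sub>C s"
    using assms s by (simp add: u_def star_add star_scaleC)
  have "u * u + star u * star u = 2 *\<^sub>R (h * h - s * s)"
    unfolding su unfolding u_def
    by (simp add: algebra_simps scaleC_simps scaleR_2)
  also have "\<dots> = (-2) *\<^sub>R (1 - 2 *\<^sub>R (h * h))"
    unfolding s(1) by (simp add: algebra_simps scaleR_2)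
  finally have "norm ((-2) *\<^sub>R (1 - 2 *\<^sub>R (h * h))) \<le> norm (u * u) + norm (star u * star u)"
    by (metis norm_triangle_ineq)
  also have "\<dots> \<le> 1 + 1"
    using norm_mult_ineq[of u u] norm_mult_ineq[of "star u" "star u"] nu by (intro add_mono) auto
  finally show ?thesis by simp
qed

lemma norm_real_minus_square:
  fixes h :: "'a::unital_cstar_algebra"
  assumes "star h = h" "(norm h)\<^sup>2 \<le> 2 * c"
  shows "norm (c *\<^sub>R 1 - h * h) \<le> c"
proof (cases "c = 0")
  case True
  with assms show ?thesis by simp
next
  case False
  have "0 \<le> c" using assms(2) zero_le_power2[of "norm h"] by linarith
  with False have c: "0 < c" by simp
  define g where "g = (1 / sqrt (2 * c)) *\<^sub>R h"
  have "norm h \<le> sqrt (2 * c)" using assms(2) by (rule real_le_rsqrt)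
  then have "norm g \<le> 1" using c by (simp add: g_def)
  then have "norm (1 - 2 *\<^sub>R (g * g)) \<le> 1"
    using assms by (intro norm_one_minus_two_squares) (simp_all add: g_def)
  moreover have "c *\<^sub>R 1 - h * h = c *\<^sub>R (1 - 2 *\<^sub>R (g * g))"
    using c by (simp add: g_def algebra_simps)
  ultimately show ?thesis using c by simp
qed

lemma positive_square:
  fixes h :: "'a::unital_cstar_algebra"
  assumes "star h = h"
  shows "positive (h * h)"
  using norm_real_minus_square[OF assms, of "(norm h)\<^sup>2"] assms
  by (auto simp: positive_def star_mult)

text \<open>The square root is a norm limit of polynomials in \<open>p\<close>, hence commutes with whatever commutes with \<open>p\<close>.\<close>

lemma positive_sqrt:
  assumes "positive p"
  obtains s where "positive s" "s * s = p" "\<forall>x. x * p = p * x \<longrightarrow> x * s = s * x"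
proof -
  obtain c where c: "norm (c *\<^sub>R 1 - p) \<le> c" and sa: "star p = p"
    using assms by (auto simp: positive_def)
  have c0: "0 \<le> c" using c norm_ge_zero[of "c *\<^sub>R 1 - p"] by linarith
  show ?thesis
  proof (cases "c = 0")
    case True
    with c have "p = 0" by simp
    then show ?thesis using that[of 0] by (auto simp: positive_def intro: exI[of _ 0])
  next
    case False
    define k where "k = 1 - (1 / c) *\<^sub>R p"
    have ck: "c *\<^sub>R k = c *\<^sub>R 1 - p" using False by (simp add: k_def algebra_simps)
    then have "norm (c *\<^sub>R k) \<le> c" using c by simp
    then have k: "norm k \<le> 1" using c0 False by simp
    define s where "s = sqrt c *\<^sub>R sqrt_one_minus k"
    have "s * s = c *\<^sub>R (1 - k)"
      using c0 by (simp add: s_def sqrt_one_minus_square[OF k])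
    then have 1: "s * s = p" using ck by (simp add: algebra_simps)
    have "sqrt c *\<^sub>R 1 - s = sqrt c *\<^sub>R (1 - sqrt_one_minus k)"
      by (simp add: s_def algebra_simps)
    then have "norm (sqrt c *\<^sub>R 1 - s) \<le> sqrt c"
      using sqrt_one_minus_near_one[OF k] c0 by (simp add: mult_left_le)
    moreover have "star s = s"
      using sa by (simp add: s_def k_def star_diff star_sqrt_one_minus[OF k, unfolded k_def])
    ultimately have 2: "positive s" by (auto simp: positive_def)
    have 3: "x * s = s * x" if "x * p = p * x" for x
      using sqrt_one_minus_commute[OF k, of x] that by (simp add: s_def k_def algebra_simps)
    show ?thesis using 1 2 3 that by blast
  qed
qed

text \<open>Since \<open>p\<close> is the square of a self-adjoint element, the constant in the definition of positivity
  can be any number that is at least half the norm of \<open>p\<close>.\<close>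

lemma norm_real_minus_positive:
  assumes "positive p" "norm p \<le> 2 * c"
  shows "norm (c *\<^sub>R 1 - p) \<le> c"
proof -
  obtain s where s: "positive s" "s * s = p" using positive_sqrt[OF assms(1)] by blast
  then show ?thesis
    using norm_real_minus_square[of s c] norm_square_selfadjoint[of s] assms(2)
    by (simp add: positive_selfadjoint)
qed

text \<open>The norm is monotone below scalars: if \<open>m = x\<^sup>2\<close> and \<open>r - m = y\<^sup>2\<close>, then \<open>x + i y\<close> has norm \<open>sqrt r\<close>
  and real part \<open>x\<close>.\<close>

lemma norm_le_of_positive_diff:
  assumes "positive m" "positive (r *\<^sub>R 1 - m)" "0 \<le> r"
  shows "norm m \<le> r"
proof -
  obtain x where x: "positive x" "x * x = m" "\<forall>z. z * m = m * z \<longrightarrow> z * x = x * z"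
    using positive_sqrt[OF assms(1)] by blast
  obtain y where y: "positive y" "y * y = r *\<^sub>R 1 - m"
    "\<forall>z. z * (r *\<^sub>R 1 - m) = (r *\<^sub>R 1 - m) * z \<longrightarrow> z * y = y * z"
    using positive_sqrt[OF assms(2)] by blast
  have "x * y = y * x"
    using x(2) by (intro y(3)[rule_format]) (auto simp: algebra_simps)
  then have "norm x \<le> sqrt r"
    using norm_real_combination_le(2)[of x y r] x(1,2) y(1,2) assms(3) by (simp add: positive_selfadjoint)
  then have "(norm x)\<^sup>2 \<le> r"
    using assms(3) real_sqrt_le_iff by (metis norm_ge_zero power_mono real_sqrt_pow2)
  then show ?thesis using norm_square_selfadjoint[of x] x(1,2) by (simp add: positive_selfadjoint)
qed

section \<open>Invertibility\<close>

definition invertible_elt :: "'a::unital_cstar_algebra \<Rightarrow> bool"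
  where "invertible_elt x \<longleftrightarrow> (\<exists>y. x * y = 1 \<and> y * x = 1)"

lemma invertible_eltI: "x * y = 1 \<Longrightarrow> y * x = 1 \<Longrightarrow> invertible_elt x"
  by (auto simp: invertible_elt_def)

lemma spectrum_iff: "z \<in> spectrum a \<longleftrightarrow> \<not> invertible_elt (a - z *\<^sub>C 1)"
  by (simp add: spectrum_def invertible_elt_def)

lemma invertible_elt_scaleC:
  assumes "c \<noteq> 0" "invertible_elt x"
  shows "invertible_elt (c *\<^sub>C x)"
proof -
  obtain y where "x * y = 1" "y * x = 1" using assms by (auto simp: invertible_elt_def)
  then show ?thesis using assms(1)
    by (intro invertible_eltI[of _ "inverse c *\<^sub>C y"])
      (simp_all add: mult_scaleC_left mult_scaleC_right scaleC_scaleC)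
qed

lemma invertible_elt_scaleR:
  assumes "c \<noteq> 0" "invertible_elt x"
  shows "invertible_elt (c *\<^sub>R x)"
  using invertible_elt_scaleC[of "of_real c" x] assms by (simp add: scaleC_of_real)

lemma invertible_elt_mult:
  assumes "invertible_elt x" "invertible_elt y"
  shows "invertible_elt (x * y)"
proof -
  obtain x' y' where "x * x' = 1" "x' * x = 1" "y * y' = 1" "y' * y = 1"
    using assms by (auto simp: invertible_elt_def)
  moreover have "x * y * (y' * x') = x * (y * y') * x'" "y' * x' * (x * y) = y' * (x' * x) * y"
    by (simp_all only: mult.assoc)
  ultimately show ?thesis by (intro invertible_eltI[of _ "y' * x'"]) simp_all
qed

lemma invertible_elt_one_minus:
  fixes x :: "'a::unital_cstar_algebra"
  assumes "norm x < 1"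
  shows "invertible_elt (1 - x)"
proof -
  have s: "summable (\<lambda>n. x ^ n)" by (rule complete_algebra_summable_geometric[OF assms])
  define S where "S = suminf (\<lambda>n. x ^ n)"
  define T where "T = suminf (\<lambda>n. x ^ Suc n)"
  have "S = 1 + T" unfolding S_def T_def using suminf_split_head[OF s] by simp
  moreover have "x * S = T"
    unfolding S_def T_def by (simp add: suminf_mult[OF s, symmetric])
  moreover have "S * x = T"
    unfolding S_def T_def by (simp add: suminf_mult2[OF s] power_commutes)
  ultimately have "(1 - x) * S = 1" "S * (1 - x) = 1"
    by (simp_all only: left_diff_distrib right_diff_distrib mult_1_left mult_1_right
        add_diff_cancel_right')
  then show ?thesis by (rule invertible_eltI)
qed

lemma invertible_elt_scaleC_minus:
  fixes x :: "'a::unital_cstar_algebra"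
  assumes "norm x < cmod c"
  shows "invertible_elt (c *\<^sub>C 1 - x)"
proof -
  have c: "c \<noteq> 0" using assms by auto
  have "norm (inverse c *\<^sub>C x) < 1"
    using assms c by (simp add: norm_scaleC norm_inverse norm_divide field_simps)
  then have "invertible_elt (c *\<^sub>C (1 - inverse c *\<^sub>C x))"
    using c by (intro invertible_elt_scaleC invertible_elt_one_minus)
  then show ?thesis using c by (simp add: scaleC_diff_right scaleC_scaleC)
qed

text \<open>The spectrum of \<open>a\<close> lies in every disc that cuts out the numerical range, because \<open>z + c\<close> is in the
  spectrum of \<open>a + c\<close> and the Neumann series bounds spectral values by the norm.\<close>

lemma spectrum_le_norm_shift:
  assumes "z \<in> spectrum a"
  shows "cmod (z + c) \<le> norm (a + c *\<^sub>C 1)"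
proof (rule ccontr)
  assume "\<not> ?thesis"
  then have "invertible_elt ((z + c) *\<^sub>C 1 - (a + c *\<^sub>C 1))"
    by (intro invertible_elt_scaleC_minus) simp
  then have "invertible_elt ((-1) *\<^sub>R ((z + c) *\<^sub>C 1 - (a + c *\<^sub>C 1)))"
    by (rule invertible_elt_scaleR[rotated]) simp
  moreover have "(-1) *\<^sub>R ((z + c) *\<^sub>C 1 - (a + c *\<^sub>C 1)) = a - z *\<^sub>C 1"
    by (simp add: scaleC_add_left)
  ultimately have "invertible_elt (a - z *\<^sub>C 1)" by (simp only:)
  then show False using assms by (simp add: spectrum_iff)
qed

text \<open>The norm of a positive element is in its spectrum. If \<open>q = \<parallel>m\<parallel> - m\<close> had an inverse \<open>b\<close>, then
  \<open>q - d = (1 - d b) q\<close> would still be positive for small \<open>d > 0\<close>, which means \<open>m \<le> \<parallel>m\<parallel> - d\<close> and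
  contradicts monotonicity of the norm.\<close>

lemma norm_minus_positive_not_invertible:
  fixes m :: "'a::unital_cstar_algebra"
  assumes "positive m"
  shows "\<not> invertible_elt (norm m *\<^sub>R 1 - m)"
proof
  define q where "q = norm m *\<^sub>R 1 - m"
  assume "invertible_elt (norm m *\<^sub>R 1 - m)"
  then obtain b where b: "q * b = 1" "b * q = 1" by (auto simp: invertible_elt_def q_def)
  have b0: "b \<noteq> 0" using b by auto
  have m0: "0 < norm m" using b by (auto simp: q_def)
  have sm: "star m = m" using assms by (rule positive_selfadjoint)
  have q: "positive q" unfolding q_def using sm by (rule positive_real_minus) simp
  then have sq: "star q = q" by (rule positive_selfadjoint)
  have sb: "star b = b"
  proof -
    have "star b * q = star (q * b)" by (simp add: star_mult sq)
    then have "star b = star b * (q * b)" "star b * q = 1" using b by simp_all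
    then show ?thesis by (metis mult.assoc mult_1_left)
  qed
  \<comment> \<open>The minimum with the norm keeps the bound \<open>\<parallel>m\<parallel> - d\<close> nonnegative, as monotonicity requires.\<close>
  define d where "d = min (1 / norm b) (norm m)"
  have d: "0 < d" "d \<le> norm m" "d * norm b \<le> 1"
  proof -
    show "0 < d" "d \<le> norm m" using b0 m0 by (auto simp: d_def)
    have "d * norm b \<le> (1 / norm b) * norm b" by (intro mult_right_mono) (auto simp: d_def)
    then show "d * norm b \<le> 1" using b0 by simp
  qed
  have "positive (1 *\<^sub>R 1 - d *\<^sub>R b)"
    using d sb by (intro positive_real_minus) simp_all
  then have pt: "positive (1 - d *\<^sub>R b)" by simp
  obtain t where t: "positive t" "t * t = 1 - d *\<^sub>R b"
    "\<forall>x. x * (1 - d *\<^sub>R b) = (1 - d *\<^sub>R b) * x \<longrightarrow> x * t = t * x"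
    using positive_sqrt[OF pt] by blast
  obtain s where s: "positive s" "s * s = q" "\<forall>x. x * q = q * x \<longrightarrow> x * s = s * x"
    using positive_sqrt[OF q] by blast
  have "b * s = s * b" using b by (intro s(3)[rule_format]) simp
  then have ts: "s * t = t * s" by (intro t(3)[rule_format]) (simp add: algebra_simps)
  have "(t * s) * (t * s) = t * (s * t) * s" by (simp only: mult.assoc)
  also have "\<dots> = (t * t) * (s * s)" by (simp only: ts mult.assoc)
  also have "\<dots> = (norm m - d) *\<^sub>R 1 - m"
    using b by (simp add: t(2) s(2) left_diff_distrib) (simp add: q_def algebra_simps)
  finally have "positive ((norm m - d) *\<^sub>R 1 - m)"
    using positive_square[of "t * s"] ts s(1) t(1) by (simp add: star_mult positive_selfadjoint)
  then have "norm m \<le> norm m - d" using assms d by (intro norm_le_of_positive_diff) auto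
  then show False using d by simp
qed

text \<open>Apply the preceding lemma to \<open>h\<^sup>2\<close> and factor \<open>\<parallel>h\<parallel>\<^sup>2 - h\<^sup>2\<close>.\<close>

lemma selfadjoint_norm_in_spectrum:
  fixes h :: "'a::unital_cstar_algebra"
  assumes "star h = h"
  shows "complex_of_real (norm h) \<in> spectrum h \<or> complex_of_real (- norm h) \<in> spectrum h"
proof (rule ccontr)
  assume "\<not> ?thesis"
  then have "invertible_elt (h - norm h *\<^sub>R 1)" "invertible_elt (h + norm h *\<^sub>R 1)"
    by (auto simp: spectrum_iff scaleC_of_real)
  then have "invertible_elt ((-1) *\<^sub>R ((h - norm h *\<^sub>R 1) * (h + norm h *\<^sub>R 1)))"
    by (intro invertible_elt_scaleR invertible_elt_mult) auto
  moreover have "(-1) *\<^sub>R ((h - norm h *\<^sub>R 1) * (h + norm h *\<^sub>R 1)) = norm (h * h) *\<^sub>R 1 - h * h"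
    using norm_square_selfadjoint[OF assms] by (simp add: algebra_simps power2_eq_square)
  ultimately show False
    using norm_minus_positive_not_invertible[OF positive_square[OF assms]] by simp
qed

section \<open>Positivity of star squares\<close>

definition re_part :: "'a::unital_cstar_algebra \<Rightarrow> 'a"
  where "re_part x = (1/2) *\<^sub>R (x + star x)"

lemma star_re_part [simp]: "star (re_part x) = re_part x"
  by (simp add: re_part_def star_add star_star add.commute)

lemma norm_re_part_le: "norm (re_part x) \<le> norm x"
  using norm_triangle_ineq[of x "star x"] by (simp add: re_part_def)

lemma re_im_decomposition: "x = re_part x + \<i> *\<^sub>C re_part (- \<i> *\<^sub>C x)"
proof -
  have "2 *\<^sub>R (re_part x + \<i> *\<^sub>C re_part (- \<i> *\<^sub>C x)) = 2 *\<^sub>R x"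
    by (simp add: re_part_def star_scaleC scaleC_simps scaleC_scaleR scaleR_scaleC scaleR_add_right scaleR_2
       scaleR_diff_right)
  then show ?thesis by simp
qed

lemma re_part_square:
  "re_part (x * x) = re_part x * re_part x - re_part (- \<i> *\<^sub>C x) * re_part (- \<i> *\<^sub>C x)"
proof -
  define h k where "h = re_part x" and "k = re_part (- \<i> *\<^sub>C x)"
  have x: "x = h + \<i> *\<^sub>C k" unfolding h_def k_def by (rule re_im_decomposition)
  have [simp]: "star h = h" "star k = k" by (simp_all add: h_def k_def)
  define u w where "u = h * h - k * k" and "w = \<i> *\<^sub>C (h * k + k * h)"
  have xx: "x * x = u + w"
    unfolding x u_def w_def by (simp add: algebra_simps scaleC_simps)
  have "star u = u" "star w = - w"
    by (simp_all add: u_def w_def star_diff star_add star_scaleC star_mult add.commute)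
  then have "re_part (x * x) = h * h - k * k"
    unfolding xx by (simp add: re_part_def star_add) (simp add: u_def flip: scaleR_2)
  then show ?thesis by (simp only: h_def k_def)
qed

lemma star_square_add_square_star:
  "star x * x + x * star x =
    2 *\<^sub>R (re_part x * re_part x + re_part (- \<i> *\<^sub>C x) * re_part (- \<i> *\<^sub>C x))"
proof -
  define h k where "h = re_part x" and "k = re_part (- \<i> *\<^sub>C x)"
  have x: "x = h + \<i> *\<^sub>C k" unfolding h_def k_def by (rule re_im_decomposition)
  have [simp]: "star h = h" "star k = k" by (simp_all add: h_def k_def)
  have "star x * x + x * star x = 2 *\<^sub>R (h * h + k * k)"
    unfolding x by (simp add: star_add star_scaleC algebra_simps scaleC_simps scaleR_2)
  then show ?thesis by (simp only: h_def k_def)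
qed

text \<open>The inverse of \<open>1 + b a\<close> is \<open>1 - b (1 + a b)\<inverse> a\<close>.\<close>

lemma invertible_elt_one_plus_swap:
  assumes "invertible_elt (1 + a * b)"
  shows "invertible_elt (1 + b * a)"
proof -
  obtain c where c: "(1 + a * b) * c = 1" "c * (1 + a * b) = 1"
    using assms by (auto simp: invertible_elt_def)
  have 1: "a * b * c = 1 - c" using c(1) by (simp add: distrib_right eq_diff_eq add.commute)
  have 2: "c * a * b = 1 - c" using c(2) by (simp add: distrib_left eq_diff_eq add.commute mult.assoc)
  have e1: "b * a * (b * c * a) = b * (a * b * c) * a" by (simp add: mult.assoc)
  have e2: "b * c * a * (b * a) = b * (c * a * b) * a" by (simp add: mult.assoc)
  show ?thesis
  proof (rule invertible_eltI[of _ "1 - b * c * a"])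
    show "(1 + b * a) * (1 - b * c * a) = 1"
      by (simp add: distrib_right right_diff_distrib e1 1) (simp add: algebra_simps)
    show "(1 - b * c * a) * (1 + b * a) = 1"
      by (simp add: distrib_left left_diff_distrib e2 2) (simp add: algebra_simps)
  qed
qed

lemma invertible_elt_one_plus_positive:
  assumes "positive k"
  shows "invertible_elt (1 + k)"
proof -
  have "norm (norm k *\<^sub>R 1 - k) \<le> norm k"
    using assms by (intro norm_real_minus_positive) simp_all
  then have "norm (norm k *\<^sub>R 1 - k) < cmod (of_real (1 + norm k))"
    by (simp only: norm_of_real)
  then have "invertible_elt (of_real (1 + norm k) *\<^sub>C 1 - (norm k *\<^sub>R 1 - k))"
    by (rule invertible_elt_scaleC_minus)
  then show ?thesis by (simp add: scaleC_of_real scaleR_add_left del: of_real_add)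
qed

text \<open>Let \<open>m = - y\<^sup>* y\<close> be positive. Then \<open>y y\<^sup>* = 2 h\<^sup>2 + 2 k\<^sup>2 + m\<close> is positive too, where \<open>h\<close> and \<open>k\<close> are
  the real and imaginary parts of \<open>y\<close>. Up to \<open>0\<close>, \<open>y\<^sup>* y\<close> and \<open>y y\<^sup>*\<close> have the same spectrum, so
  \<open>\<parallel>m\<parallel>\<close> cannot be a nonzero spectral value of \<open>m\<close>.\<close>

lemma star_square_nonpos_imp_zero:
  fixes y :: "'a::unital_cstar_algebra"
  assumes "positive (- (star y * y))"
  shows "y = 0"
proof (rule ccontr)
  assume y: "y \<noteq> 0"
  define m where "m = - (star y * y)"
  have m0: "0 < norm m" using y by (simp add: m_def cstar_identity)
  have "y * star y = 2 *\<^sub>R (re_part y * re_part y + re_part (- \<i> *\<^sub>C y) * re_part (- \<i> *\<^sub>C y)) + m"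
    by (simp only: m_def star_square_add_square_star[symmetric]) simp
  then have "positive (y * star y)"
    using assms by (simp only: m_def) (intro positive_add positive_scaleR positive_square, simp_all)
  then have "positive ((1 / norm m) *\<^sub>R (y * star y))"
    by (rule positive_scaleR) simp
  then have "invertible_elt (1 + (1 / norm m) *\<^sub>R (y * star y))"
    by (rule invertible_elt_one_plus_positive)
  then have "invertible_elt (1 + star y * ((1 / norm m) *\<^sub>R y))"
    using invertible_elt_one_plus_swap[of "(1 / norm m) *\<^sub>R y" "star y"] by simp
  then have "invertible_elt (norm m *\<^sub>R (1 + star y * ((1 / norm m) *\<^sub>R y)))"
    using m0 by (intro invertible_elt_scaleR) simp_all
  moreover have "norm m *\<^sub>R (1 + star y * ((1 / norm m) *\<^sub>R y)) = norm m *\<^sub>R 1 - m"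
    using m0 by (simp add: scaleR_add_right) (simp add: m_def)
  ultimately show False
    using norm_minus_positive_not_invertible[of m] assms by (simp add: m_def)
qed

text \<open>Write \<open>h = x\<^sup>* x\<close>, \<open>g = |h|\<close> and \<open>v = g - h\<close>, which is twice the negative part of \<open>h\<close>. Then
  \<open>(x v)\<^sup>* (x v) = v h v = - v\<^sup>3 / 2\<close>, and \<open>v\<^sup>3 = 2 v g v\<close> is positive because \<open>g\<close> has a square
  root that commutes with \<open>v\<close>. By the preceding lemma \<open>x v = 0\<close>, hence \<open>v = 0\<close> and \<open>h = |h|\<close>.\<close>

theorem positive_star_square:
  fixes x :: "'a::unital_cstar_algebra"
  shows "positive (star x * x)"
proof -
  define h where "h = star x * x"
  have sh: "star h = h" by (simp add: h_def star_mult star_star)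
  obtain g where g: "positive g" "g * g = h * h" "\<forall>z. z * (h * h) = (h * h) * z \<longrightarrow> z * g = g * z"
    using positive_sqrt[OF positive_square[OF sh]] by blast
  have hg: "h * g = g * h" by (rule g(3)[rule_format]) (simp add: mult.assoc)
  obtain r where r: "positive r" "r * r = g" "\<forall>z. z * g = g * z \<longrightarrow> z * r = r * z"
    using positive_sqrt[OF g(1)] by blast
  define v where "v = g - h"
  have sg: "star g = g" and sr: "star r = r" using g(1) r(1) by (simp_all add: positive_selfadjoint)
  have sv: "star v = v" using sg sh by (simp add: v_def star_diff)
  have vg: "v * g = g * v" using hg by (simp add: v_def algebra_simps)
  have vr: "v * r = r * v" by (rule r(3)[rule_format, OF vg])
  have vv: "v * v = 2 *\<^sub>R (g * v)" using g(2) hg by (simp add: v_def algebra_simps scaleR_2)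
  have hv: "(-2) *\<^sub>R (h * v) = v * v" using g(2) hg by (simp add: v_def algebra_simps scaleR_2)
  have "(r * v) * (r * v) = r * (v * r) * v" by (simp only: mult.assoc)
  also have "\<dots> = g * v * v" by (simp only: vr r(2)[symmetric] mult.assoc)
  also have "\<dots> = v * (g * v)" by (simp only: vg[symmetric] mult.assoc)
  also have "\<dots> = (1/2) *\<^sub>R (v * (v * v))" using vv by simp
  also have "\<dots> = - (v * (h * v))"
    by (simp flip: hv)
  also have "\<dots> = - (star (x * v) * (x * v))"
    by (simp add: h_def star_mult sv mult.assoc)
  finally have "positive (- (star (x * v) * (x * v)))"
    using positive_square[of "r * v"] vr sr sv by (simp add: star_mult)
  then have "x * v = 0" by (rule star_square_nonpos_imp_zero)
  then have "h * v = 0" by (simp add: h_def mult.assoc)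
  then have "v * v = 0" using hv by simp
  then have "v = 0" using norm_square_selfadjoint[OF sv] by simp
  then show ?thesis using g(1) by (simp add: v_def h_def)
qed

section \<open>The Hahn-Banach theorem\<close>

definition sublinear :: "('a::real_vector \<Rightarrow> real) \<Rightarrow> bool"
  where "sublinear p \<longleftrightarrow>
    (\<forall>x y. p (x + y) \<le> p x + p y) \<and> (\<forall>t x. 0 \<le> t \<longrightarrow> p (t *\<^sub>R x) = t * p x)"

lemma sublinear_add: "sublinear p \<Longrightarrow> p (x + y) \<le> p x + p y"
  and sublinear_scaleR: "sublinear p \<Longrightarrow> 0 \<le> t \<Longrightarrow> p (t *\<^sub>R x) = t * p x"
  by (simp_all add: sublinear_def)

lemma sublinear_zero: "sublinear p \<Longrightarrow> p 0 = 0"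
  using sublinear_scaleR[of p 0 0] by simp

lemma sublinear_minus: "sublinear p \<Longrightarrow> - p (- x) \<le> p x"
  using sublinear_add[of p x "-x"] sublinear_zero[of p] by simp

lemma sublinearI:
  assumes add: "\<And>x y. p (x + y) \<le> p x + p y" and zero: "p 0 = 0"
    and scale: "\<And>t x. 0 < t \<Longrightarrow> p (t *\<^sub>R x) \<le> t * p x"
  shows "sublinear p"
  unfolding sublinear_def
proof (intro conjI allI impI)
  fix t :: real and x assume "0 \<le> t"
  show "p (t *\<^sub>R x) = t * p x"
  proof (cases "t = 0")
    case False
    with \<open>0 \<le> t\<close> have t: "0 < t" by simp
    have "p x \<le> inverse t * p (t *\<^sub>R x)"
      using scale[of "inverse t" "t *\<^sub>R x"] t by simp
    with scale[OF t, of x] t show ?thesis by (simp add: field_simps)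
  qed (simp add: zero)
qed (rule add)

text \<open>Given a convex cone of prescriptions (the functional is to be at least \<open>s\<close> at \<open>y\<close>) compatible with \<open>p\<close>,
  the infimum of \<open>p (x + y) - s\<close> over the cone is a sublinear functional below \<open>p\<close>, and every
  linear functional below it meets all the prescriptions. A prescription on a ray yields
  the linearity of minimal sublinear functionals; one on a subspace yields the extension of a functional.\<close>

lemma sublinear_cone_reduction:
  fixes p :: "'a::real_vector \<Rightarrow> real"
  assumes p: "sublinear p" and C0: "(0, 0) \<in> C"
    and Cadd: "\<And>y s z t. (y, s) \<in> C \<Longrightarrow> (z, t) \<in> C \<Longrightarrow> (y + z, s + t) \<in> C"
    and Cscale: "\<And>c y s. 0 < c \<Longrightarrow> (y, s) \<in> C \<Longrightarrow> (c *\<^sub>R y, c * s) \<in> C"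
    and Cle: "\<And>y s. (y, s) \<in> C \<Longrightarrow> s \<le> p y"
  obtains q where "sublinear q" "\<And>x. q x \<le> p x" "\<And>y s. (y, s) \<in> C \<Longrightarrow> q (- y) \<le> - s"
proof -
  define S where "S x = {p (x + y) - s |y s. (y, s) \<in> C}" for x
  define q where "q x = Inf (S x)" for x
  have bdd: "bdd_below (S x)" for x
  proof (rule bdd_belowI[of _ "- p (- x)"])
    fix r assume "r \<in> S x"
    then obtain y s where r: "r = p (x + y) - s" "(y, s) \<in> C" by (auto simp: S_def)
    show "- p (- x) \<le> r"
      using sublinear_add[OF p, of "x + y" "- x"] Cle[OF r(2)] r(1) by simp
  qed
  have ne: "S x \<noteq> {}" for x using C0 by (auto simp: S_def)
  have le: "q x \<le> p (x + y) - s" if "(y, s) \<in> C" for x y s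
    unfolding q_def using that by (intro cInf_lower bdd) (auto simp: S_def)
  have less: "\<exists>y s. (y, s) \<in> C \<and> p (x + y) - s < b" if "q x < b" for x b
    using that cInf_lessD[OF ne, of x b] unfolding q_def by (auto simp: S_def)
  have qp: "q x \<le> p x" for x using le[OF C0, of x] by simp
  have qC: "q (- y) \<le> - s" if "(y, s) \<in> C" for y s
    using le[OF that, of "- y"] sublinear_zero[OF p] by simp
  have "sublinear q"
  proof (rule sublinearI)
    fix x x'
    show "q (x + x') \<le> q x + q x'"
    proof (rule field_le_epsilon)
      fix e :: real assume "0 < e"
      then obtain y s y' s' where C: "(y, s) \<in> C" "(y', s') \<in> C"
        and l: "p (x + y) - s < q x + e/2" "p (x' + y') - s' < q x' + e/2"
        using less[of x "q x + e/2"] less[of x' "q x' + e/2"] by auto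
      have "q (x + x') \<le> p ((x + y) + (x' + y')) - (s + s')"
        using le[OF Cadd[OF C], of "x + x'"] by (simp add: algebra_simps)
      also have "\<dots> \<le> p (x + y) + p (x' + y') - (s + s')"
        using sublinear_add[OF p] by simp
      also have "\<dots> \<le> q x + q x' + e" using l by simp
      finally show "q (x + x') \<le> q x + q x' + e" .
    qed
  next
    have "0 \<le> q 0"
      unfolding q_def
      by (rule cInf_greatest[OF ne]) (auto simp: S_def dest: Cle)
    with qp[of 0] sublinear_zero[OF p] show "q 0 = 0" by simp
  next
    fix t :: real and x assume t: "0 < t"
    show "q (t *\<^sub>R x) \<le> t * q x"
    proof (rule field_le_epsilon)
      fix e :: real assume "0 < e"
      then obtain y s where C: "(y, s) \<in> C" and l: "p (x + y) - s < q x + e / t"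
        using less[of x "q x + e / t"] t by auto
      have "q (t *\<^sub>R x) \<le> p (t *\<^sub>R (x + y)) - t * s"
        using le[OF Cscale[OF t C], of "t *\<^sub>R x"] by (simp add: scaleR_add_right)
      also have "\<dots> = t * (p (x + y) - s)"
        using t by (simp only: sublinear_scaleR[OF p less_imp_le] right_diff_distrib)
      also have "\<dots> \<le> t * (q x + e / t)" using l t by (intro mult_left_mono) simp_all
      also have "\<dots> = t * q x + e" using t by (simp add: algebra_simps)
      finally show "q (t *\<^sub>R x) \<le> t * q x + e" .
    qed
  qed
  with qp qC that show ?thesis by blast
qed

text \<open>Prescribe the value \<open>p y\<close> at \<open>y\<close>. By minimality this does not lower \<open>p\<close>, so
  \<open>p (- y) \<le> - p y\<close>, and \<open>p\<close> is additive.\<close>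

lemma minimal_sublinear_linear:
  fixes p :: "'a::real_vector \<Rightarrow> real"
  assumes p: "sublinear p" and min: "\<And>q. sublinear q \<Longrightarrow> (\<And>x. q x \<le> p x) \<Longrightarrow> q = p"
  shows "linear p"
proof -
  have add: "p (x + y) = p x + p y" for x y
  proof -
    \<comment> \<open>The ray through \<open>y\<close>, with \<open>p\<close> itself as the prescribed value.\<close>
    let ?C = "{(t *\<^sub>R y, t * p y) |t. 0 \<le> t}"
    obtain q where q: "sublinear q" "\<And>x. q x \<le> p x" "\<And>z s. (z, s) \<in> ?C \<Longrightarrow> q (- z) \<le> - s"
    proof (rule sublinear_cone_reduction[OF p, of ?C])
      show "(0, 0) \<in> ?C" by (auto intro!: exI[of _ 0])
      show "(u + w, s + t) \<in> ?C" if "(u, s) \<in> ?C" "(w, t) \<in> ?C" for u s w t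
        using that by (auto simp flip: scaleR_add_left distrib_right)
      show "(c *\<^sub>R u, c * s) \<in> ?C" if c: "0 < c" and u: "(u, s) \<in> ?C" for c u s
      proof -
        obtain t where "u = t *\<^sub>R y" "s = t * p y" "0 \<le> t" using u by blast
        then have "c *\<^sub>R u = (c * t) *\<^sub>R y" "c * s = (c * t) * p y" "0 \<le> c * t"
          using c by simp_all
        then show ?thesis by blast
      qed
      show "s \<le> p u" if "(u, s) \<in> ?C" for u s
        using that sublinear_scaleR[OF p] by auto
    qed blast
    have "q = p" using q by (intro min)
    moreover have "q (- y) \<le> - p y" by (rule q(3)) (auto intro!: exI[of _ 1])
    ultimately have "p (- y) \<le> - p y" by simp
    then show ?thesis
      using sublinear_add[OF p, of x y] sublinear_add[OF p, of "x + y" "- y"] by simp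
  qed
  have neg: "p (- x) = - p x" for x using add[of x "- x"] sublinear_zero[OF p] by simp
  show ?thesis
  proof (rule linearI)
    fix c x show "p (c *\<^sub>R x) = c *\<^sub>R p x"
      using sublinear_scaleR[OF p, of c x] sublinear_scaleR[OF p, of "- c" x] neg[of "c *\<^sub>R x"]
      by (cases "0 \<le> c") auto
  qed (rule add)
qed

text \<open>The Hahn-Banach theorem, by Zorn's lemma: the pointwise infimum of a chain of sublinear functionals
  below \<open>p\<close> is sublinear (it is finite since \<open>q x \<ge> - p (- x)\<close>), and a minimal one is linear.\<close>

lemma linear_below_sublinear:
  fixes p :: "'a::real_vector \<Rightarrow> real"
  assumes p: "sublinear p"
  obtains f where "linear f" "\<And>x. f x \<le> p x"
proof -
  define A where "A = {q. sublinear q \<and> q \<le> p}"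
  have "\<exists>m\<in>A. \<forall>a\<in>A. a \<le> m \<longrightarrow> a = m"
  proof (rule predicate_Zorn[where P="\<lambda>a b. b \<le> a"])
    show "partial_order_on A (relation_of (\<lambda>a b. b \<le> a) A)"
      by (rule partial_order_on_relation_ofI) auto
  next
    fix C assume C: "C \<in> Chains (relation_of (\<lambda>a b. b \<le> a) A)"
    then have CA: "C \<subseteq> A" and total: "\<And>a b. a \<in> C \<Longrightarrow> b \<in> C \<Longrightarrow> a \<le> b \<or> b \<le> a"
      by (auto simp: Chains_def relation_of_def)
    show "\<exists>u\<in>A. \<forall>a\<in>C. u \<le> a"
    proof (cases "C = {}")
      case True
      then show ?thesis using p by (auto simp: A_def)
    next
      case False
      define u where "u x = (INF q\<in>C. q x)" for x
      have bdd: "bdd_below ((\<lambda>q. q x) ` C)" for x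
      proof (rule bdd_belowI2[of _ "- p (- x)"])
        fix q assume "q \<in> C"
        then have q: "sublinear q" "q \<le> p" using CA by (auto simp: A_def)
        show "- p (- x) \<le> q x"
          using sublinear_minus[OF q(1), of x] le_funD[OF q(2), of "- x"] by simp
      qed
      have le: "u x \<le> q x" if "q \<in> C" for q x
        unfolding u_def using that bdd by (rule cINF_lower[rotated])
      have less: "\<exists>q\<in>C. q x < b" if "u x < b" for x b
        using that False bdd unfolding u_def by (subst (asm) cINF_less_iff) auto
      have "sublinear u"
      proof (rule sublinearI)
        fix x y show "u (x + y) \<le> u x + u y"
        proof (rule field_le_epsilon)
          fix e :: real assume "0 < e"
          then obtain q r where q: "q \<in> C" "q x < u x + e/2" and r: "r \<in> C" "r y < u y + e/2"
            using less[of x "u x + e/2"] less[of y "u y + e/2"] by auto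
          then obtain w where w: "w \<in> C" "w \<le> q" "w \<le> r" using total[of q r] by auto
          have "u (x + y) \<le> w (x + y)" using w by (intro le)
          also have "\<dots> \<le> w x + w y" using w CA by (intro sublinear_add) (auto simp: A_def)
          also have "\<dots> \<le> u x + u y + e"
            using q r le_funD[OF w(2), of x] le_funD[OF w(3), of y] by simp
          finally show "u (x + y) \<le> u x + u y + e" .
        qed
      next
        have zero: "q 0 = 0" if "q \<in> C" for q using that CA by (auto simp: A_def sublinear_zero)
        have "(\<lambda>q. q 0) ` C = (\<lambda>q. 0) ` C" by (rule image_cong[OF refl], rule zero)
        then have "(\<lambda>q. q 0) ` C = {0}" by (simp only: image_constant_conv \<open>C \<noteq> {}\<close> if_False)
        then show "u 0 = 0" by (simp add: u_def)
      next
        fix t :: real and x assume t: "0 < t"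
        show "u (t *\<^sub>R x) \<le> t * u x"
        proof (rule field_le_epsilon)
          fix e :: real assume "0 < e"
          then obtain q where q: "q \<in> C" "q x < u x + e / t"
            using less[of x "u x + e / t"] t by auto
          have "u (t *\<^sub>R x) \<le> q (t *\<^sub>R x)" using q by (intro le)
          also have "\<dots> = t * q x" using q CA t by (intro sublinear_scaleR) (auto simp: A_def)
          also have "\<dots> \<le> t * (u x + e / t)" using q t by (intro mult_left_mono) simp_all
          also have "\<dots> = t * u x + e" using t by (simp add: algebra_simps)
          finally show "u (t *\<^sub>R x) \<le> t * u x + e" .
        qed
      qed
      moreover have "u \<le> p"
      proof (rule le_funI)
        fix x
        obtain q where q: "q \<in> C" using False by blast
        then have "q \<le> p" using CA by (auto simp: A_def)
        then show "u x \<le> p x" using le[OF q, of x] le_funD[of q p x] by simp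
      qed
      ultimately show ?thesis using le by (auto simp: A_def le_fun_def)
    qed
  qed
  then obtain m where m: "sublinear m" "m \<le> p" and min: "\<And>a. a \<in> A \<Longrightarrow> a \<le> m \<Longrightarrow> a = m"
    by (auto simp: A_def)
  have "linear m"
  proof (rule minimal_sublinear_linear[OF m(1)])
    fix q assume q: "sublinear q" "\<And>x. q x \<le> m x"
    then have "q \<le> m" by (intro le_funI)
    moreover from this have "q \<le> p" using m(2) by simp
    ultimately show "q = m" using q(1) by (intro min) (simp_all add: A_def)
  qed
  with m(2) that show ?thesis by (auto simp: le_fun_def)
qed

section \<open>States and the numerical range\<close>

lemma
  assumes "\<phi> \<in> states"
  shows state_bounded_linear: "bounded_linear \<phi>"
    and state_add: "\<phi> (x + y) = \<phi> x + \<phi> y"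
    and state_diff: "\<phi> (x - y) = \<phi> x - \<phi> y"
    and state_scaleC: "\<phi> (c *\<^sub>C x) = c * \<phi> x"
    and state_star_square: "\<phi> (star x * x) \<in> \<real>\<^sub>\<ge>\<^sub>0"
    and state_onorm: "onorm \<phi> = 1"
proof -
  show b: "bounded_linear \<phi>" using assms by (simp add: states_def)
  interpret bounded_linear \<phi> by (rule b)
  show "\<phi> (x + y) = \<phi> x + \<phi> y" "\<phi> (x - y) = \<phi> x - \<phi> y" by (rule add diff)+
qed (use assms in \<open>auto simp: states_def\<close>)

lemma state_scaleR: "\<phi> \<in> states \<Longrightarrow> \<phi> (r *\<^sub>R x) = of_real r * \<phi> x"
  using state_scaleC[of \<phi> "of_real r" x] by (simp add: scaleC_of_real)

lemma state_positive:
  assumes "\<phi> \<in> states" "positive p"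
  shows "\<phi> p \<in> \<real>\<^sub>\<ge>\<^sub>0"
proof -
  obtain s where "positive s" "s * s = p" using positive_sqrt[OF assms(2)] by blast
  then show ?thesis
    using state_star_square[OF assms(1), of s] by (simp add: positive_selfadjoint)
qed

text \<open>States are positive on \<open>\<parallel>h\<parallel> - h\<close> and \<open>\<parallel>h\<parallel> + h\<close>.\<close>

lemma state_selfadjoint:
  assumes \<phi>: "\<phi> \<in> states" and h: "star h = h"
  shows "\<phi> h \<in> \<real>" "\<bar>Re (\<phi> h)\<bar> \<le> Re (\<phi> 1) * norm h"
proof -
  have one: "\<phi> 1 \<in> \<real>\<^sub>\<ge>\<^sub>0" using state_star_square[OF \<phi>, of 1] by simp
  have "\<phi> (norm h *\<^sub>R 1 - h) \<in> \<real>\<^sub>\<ge>\<^sub>0" "\<phi> (norm h *\<^sub>R 1 - (- h)) \<in> \<real>\<^sub>\<ge>\<^sub>0"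
    using h by (intro state_positive[OF \<phi>] positive_real_minus; simp)+
  then have "of_real (norm h) * \<phi> 1 - \<phi> h \<in> \<real>\<^sub>\<ge>\<^sub>0" "of_real (norm h) * \<phi> 1 + \<phi> h \<in> \<real>\<^sub>\<ge>\<^sub>0"
    by (simp_all add: state_diff[OF \<phi>] state_add[OF \<phi>] state_scaleR[OF \<phi>])
  with one show "\<phi> h \<in> \<real>" "\<bar>Re (\<phi> h)\<bar> \<le> Re (\<phi> 1) * norm h"
    by (auto simp: complex_nonneg_Reals_iff complex_is_Real_iff mult.commute)
qed

lemma state_star:
  assumes \<phi>: "\<phi> \<in> states"
  shows "\<phi> (star x) = cnj (\<phi> x)"
proof -
  define h k where "h = re_part x" and "k = re_part (- \<i> *\<^sub>C x)"
  have x: "x = h + \<i> *\<^sub>C k" unfolding h_def k_def by (rule re_im_decomposition)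
  have s: "star h = h" "star k = k" by (simp_all add: h_def k_def)
  have "cnj (\<phi> h) = \<phi> h" "cnj (\<phi> k) = \<phi> k"
    using state_selfadjoint(1)[OF \<phi>] s by (simp_all add: Reals_cnj_iff)
  then show ?thesis
    unfolding x by (simp add: star_add star_scaleC s state_add[OF \<phi>] state_diff[OF \<phi>] state_scaleC[OF \<phi>])
qed

lemma state_re_part:
  assumes "\<phi> \<in> states"
  shows "\<phi> (re_part x) = of_real (Re (\<phi> x))"
  unfolding re_part_def
  by (simp add: state_scaleR[OF assms] state_add[OF assms] state_star[OF assms] complex_add_cnj)

lemma exists_unit_rotation: "\<exists>w. cmod w = 1 \<and> w * z = of_real (cmod z)"
proof (cases "z = 0")
  case False
  then show ?thesis
    by (intro exI[of _ "cnj z / of_real (cmod z)"])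
      (simp add: norm_divide complex_norm_square[symmetric] mult.commute power2_eq_square)
qed (auto intro: exI[of _ 1])

text \<open>Rotating \<open>x\<close> so that its value becomes nonnegative and passing to the real part reduces the bound
  \<open>|\<phi> x| \<le> \<phi> 1 \<parallel>x\<parallel>\<close> to self-adjoint \<open>x\<close>; it forces \<open>1 = \<parallel>\<phi>\<parallel> \<le> \<phi> 1\<close>.\<close>

lemma state_one:
  assumes \<phi>: "\<phi> \<in> states"
  shows "\<phi> 1 = 1"
proof -
  have bound: "norm (\<phi> x) \<le> Re (\<phi> 1) * norm x" for x
  proof -
    obtain w where w: "cmod w = 1" "w * \<phi> x = of_real (cmod (\<phi> x))"
      using exists_unit_rotation by blast
    have "cmod (\<phi> x) = \<bar>Re (\<phi> (re_part (w *\<^sub>C x)))\<bar>"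
      by (simp add: state_re_part[OF \<phi>] state_scaleC[OF \<phi>] w)
    also have "\<dots> \<le> Re (\<phi> 1) * norm (re_part (w *\<^sub>C x))"
      by (rule state_selfadjoint(2)[OF \<phi>]) simp
    also have "\<dots> \<le> Re (\<phi> 1) * norm x"
      using norm_re_part_le[of "w *\<^sub>C x"] w state_selfadjoint(2)[OF \<phi>, of 1]
      by (intro mult_left_mono) (simp_all add: norm_scaleC)
    finally show ?thesis .
  qed
  have "onorm \<phi> \<le> Re (\<phi> 1)"
    using state_selfadjoint(2)[OF \<phi>, of 1] by (intro onorm_bound bound) simp
  moreover have "Re (\<phi> 1) \<le> cmod (\<phi> 1)" by (rule complex_Re_le_cmod)
  moreover have "cmod (\<phi> 1) \<le> 1"
    using onorm[OF state_bounded_linear[OF \<phi>], of 1] state_onorm[OF \<phi>] by simp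
  ultimately have "Re (\<phi> 1) = 1" using state_onorm[OF \<phi>] by simp
  moreover have "Im (\<phi> 1) = 0"
    using state_selfadjoint(1)[OF \<phi>, of 1] by (simp add: complex_is_Real_iff)
  ultimately show ?thesis by (simp add: complex_eq_iff)
qed

lemma state_shift:
  assumes "\<phi> \<in> states"
  shows "\<phi> (a + c *\<^sub>C 1) = \<phi> a + c"
  by (simp add: state_add[OF assms] state_scaleC[OF assms] state_one[OF assms])

lemma state_norm_le:
  assumes "\<phi> \<in> states"
  shows "cmod (\<phi> x) \<le> norm x"
  using onorm[OF state_bounded_linear[OF assms], of x] state_onorm[OF assms] by simp

text \<open>Values at self-adjoint \<open>h\<close> are real: \<open>|\<phi> h + i t|\<^sup>2 \<le> \<parallel>h + i t\<parallel>\<^sup>2 \<le> \<parallel>h\<parallel>\<^sup>2 + t\<^sup>2\<close> for all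
  real \<open>t\<close>, whereas a nonzero imaginary part of \<open>\<phi> h\<close> would make the left side grow faster for one
  sign of \<open>t\<close>. For \<open>p = x\<^sup>* x\<close> positivity means \<open>\<parallel>\<parallel>p\<parallel> - p\<parallel> \<le> \<parallel>p\<parallel>\<close>, hence
  \<open>|\<parallel>p\<parallel> - \<phi> p| \<le> \<parallel>p\<parallel>\<close>.\<close>

lemma unital_contraction_is_state:
  fixes \<phi> :: "'a::unital_cstar_algebra \<Rightarrow> complex"
  assumes add: "\<And>x y. \<phi> (x + y) = \<phi> x + \<phi> y"
    and scale: "\<And>c x. \<phi> (c *\<^sub>C x) = c * \<phi> x"
    and bound: "\<And>x. cmod (\<phi> x) \<le> norm x" and one: "\<phi> 1 = 1"
  shows "\<phi> \<in> states"
proof -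
  have scaleR: "\<phi> (r *\<^sub>R x) = r *\<^sub>R \<phi> x" for r x
    using scale[of "of_real r" x] by (simp add: scaleC_of_real scaleR_conv_of_real)
  have bl: "bounded_linear \<phi>"
    by (rule bounded_linear_intro[where K=1]) (simp_all add: add scaleR bound)
  have real: "Im (\<phi> h) = 0" if h: "star h = h" for h
  proof (rule ccontr)
    let ?b = "Im (\<phi> h)"
    assume b: "?b \<noteq> 0"
    \<comment> \<open>Chosen to make \<open>b\<^sup>2 + 2 b t \<le> \<parallel>h\<parallel>\<^sup>2\<close> fail for the imaginary part \<open>b\<close>.\<close>
    define t where "t = ((norm h)\<^sup>2 + 1) / (2 * ?b)"
    have bt: "2 * ?b * t = (norm h)\<^sup>2 + 1" using b by (simp add: t_def)
    let ?x = "h + (\<i> * of_real t) *\<^sub>C 1"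
    have sx: "star ?x = h - (\<i> * of_real t) *\<^sub>C 1"
      by (simp add: star_add star_scaleC h)
    have "star ?x * ?x = h * h + of_real (t * t) *\<^sub>C 1"
      unfolding sx by (simp add: algebra_simps scaleC_simps)
    then have "(norm ?x)\<^sup>2 = norm (h * h + t\<^sup>2 *\<^sub>R 1)"
      using cstar_identity[of ?x] by (simp only: scaleC_of_real power2_eq_square)
    also have "\<dots> \<le> (norm h)\<^sup>2 + t\<^sup>2"
      using norm_triangle_ineq[of "h * h" "t\<^sup>2 *\<^sub>R 1"] norm_square_selfadjoint[OF h] by simp
    finally have "(norm ?x)\<^sup>2 \<le> (norm h)\<^sup>2 + t\<^sup>2" .
    moreover have "(?b + t)\<^sup>2 \<le> (norm ?x)\<^sup>2"
    proof -
      have "\<bar>?b + t\<bar> = \<bar>Im (\<phi> ?x)\<bar>" by (simp add: add scale one)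
      also have "\<dots> \<le> norm ?x" using abs_Im_le_cmod[of "\<phi> ?x"] bound[of ?x] by linarith
      finally show ?thesis by (simp only: abs_le_square_iff[symmetric] abs_norm_cancel)
    qed
    ultimately have "?b\<^sup>2 + 2 * ?b * t \<le> (norm h)\<^sup>2" by (simp add: power2_sum)
    then have "?b\<^sup>2 + 1 \<le> 0" using bt by linarith
    then show False using zero_le_power2[of ?b] by linarith
  qed
  have pos: "\<phi> (star x * x) \<in> \<real>\<^sub>\<ge>\<^sub>0" for x
  proof -
    let ?p = "star x * x"
    have "norm (norm ?p *\<^sub>R 1 - ?p) \<le> norm ?p"
      by (rule norm_real_minus_positive[OF positive_star_square]) simp
    then have "cmod (\<phi> (norm ?p *\<^sub>R 1 - ?p)) \<le> norm ?p" by (rule order_trans[OF bound])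
    moreover have "\<phi> (norm ?p *\<^sub>R 1 - ?p) = of_real (norm ?p) - \<phi> ?p"
      by (simp add: linear_diff[OF bounded_linear.linear[OF bl]] scaleR one)
        (simp add: scaleR_conv_of_real)
    ultimately have "\<bar>norm ?p - Re (\<phi> ?p)\<bar> \<le> norm ?p"
      using abs_Re_le_cmod[of "\<phi> (norm ?p *\<^sub>R 1 - ?p)"] by simp
    then show ?thesis using real[of ?p] by (simp add: complex_nonneg_Reals_iff star_mult star_star)
  qed
  have "onorm \<phi> \<le> 1" using bound by (intro onorm_bound) simp_all
  moreover have "1 \<le> onorm \<phi>" using onorm[OF bl, of 1] one by simp
  ultimately show ?thesis using bl scale pos by (simp add: states_def)
qed

lemma sublinear_norm: "sublinear norm"
  by (simp add: sublinear_def norm_triangle_ineq)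

text \<open>If \<open>z\<close> lies in all the discs, then \<open>u + v a \<mapsto> u + v z\<close> is a contraction on the span of \<open>1\<close> and \<open>a\<close>. The
  real part of this map extends to a real functional \<open>f\<close> bounded by the norm; the
  complex functional with real part \<open>f\<close> is again a contraction, hence a state.\<close>

theorem numerical_range_iff:
  fixes a :: "'a::unital_cstar_algebra"
  shows "z \<in> numerical_range a \<longleftrightarrow> (\<forall>c. cmod (z + c) \<le> norm (a + c *\<^sub>C 1))"
proof
  assume "z \<in> numerical_range a"
  then obtain \<phi> where \<phi>: "\<phi> \<in> states" "z = \<phi> a" by (auto simp: numerical_range_def)
  show "\<forall>c. cmod (z + c) \<le> norm (a + c *\<^sub>C 1)"
  proof
    fix c show "cmod (z + c) \<le> norm (a + c *\<^sub>C 1)"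
      using state_norm_le[OF \<phi>(1), of "a + c *\<^sub>C 1"] \<phi> by (simp add: state_shift)
  qed
next
  assume z: "\<forall>c. cmod (z + c) \<le> norm (a + c *\<^sub>C 1)"
  \<comment> \<open>The cone of prescriptions is the graph of the real part of the map on the span of \<open>1\<close> and \<open>a\<close>.\<close>
  define y where "y u v = u *\<^sub>C 1 + v *\<^sub>C a" for u v
  have yle: "cmod (u + v * z) \<le> norm (y u v)" for u v
  proof (cases "v = 0")
    case True
    then show ?thesis by (simp add: y_def norm_scaleC)
  next
    case False
    have "cmod v * cmod (z + u / v) \<le> cmod v * norm (a + (u / v) *\<^sub>C 1)"
      using z by (intro mult_left_mono) auto
    also have "\<dots> = norm (v *\<^sub>C (a + (u / v) *\<^sub>C 1))" by (simp add: norm_scaleC)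
    also have "v *\<^sub>C (a + (u / v) *\<^sub>C 1) = y u v"
      using False by (simp add: y_def scaleC_simps add.commute)
    also have "cmod v * cmod (z + u / v) = cmod (u + v * z)"
      using False by (simp add: norm_mult[symmetric] algebra_simps)
    finally show ?thesis .
  qed
  define C where "C = {(y u v, Re (u + v * z)) |u v. True}"
  have C: "(y u v, Re (u + v * z)) \<in> C" for u v by (auto simp: C_def)
  obtain q where q: "sublinear q" "\<And>x. q x \<le> norm x" "\<And>y s. (y, s) \<in> C \<Longrightarrow> q (- y) \<le> - s"
  proof (rule sublinear_cone_reduction[OF sublinear_norm, of C])
    show "(0, 0) \<in> C" using C[of 0 0] by (simp add: y_def)
    show "(x + x', s + t) \<in> C" if xs: "(x, s) \<in> C" "(x', t) \<in> C" for x s x' t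
    proof -
      obtain u v u' v' where e: "x = y u v" "s = Re (u + v * z)" "x' = y u' v'" "t = Re (u' + v' * z)"
        using xs unfolding C_def by blast
      have "x + x' = y (u + u') (v + v')" by (simp add: e y_def scaleC_add_left)
      moreover have "s + t = Re ((u + u') + (v + v') * z)" by (simp add: e algebra_simps)
      ultimately show ?thesis using C by metis
    qed
    show "(c *\<^sub>R x, c * s) \<in> C" if xs: "(x, s) \<in> C" for c x s
    proof -
      obtain u v where e: "x = y u v" "s = Re (u + v * z)" using xs unfolding C_def by blast
      have "c *\<^sub>R x = y (of_real c * u) (of_real c * v)"
        by (simp add: e y_def scaleR_add_right scaleR_scaleC)
      moreover have "c * s = Re (of_real c * u + (of_real c * v) * z)" by (simp add: e algebra_simps)
      ultimately show ?thesis using C by metis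
    qed
    show "s \<le> norm x" if xs: "(x, s) \<in> C" for x s
    proof -
      obtain u v where e: "x = y u v" "s = Re (u + v * z)" using xs unfolding C_def by blast
      show ?thesis unfolding e by (rule order_trans[OF complex_Re_le_cmod yle])
    qed
  qed blast
  obtain f where f: "linear f" "\<And>x. f x \<le> q x" using linear_below_sublinear[OF q(1)] by blast
  interpret linear f by (rule f(1))
  have fy: "f (y u v) = Re (u + v * z)" for u v
  proof (rule antisym)
    have "f (- y (- u) (- v)) \<le> - Re (- u + - v * z)" by (rule order_trans[OF f(2) q(3)[OF C]])
    then show "f (y u v) \<le> Re (u + v * z)" by (simp add: y_def algebra_simps)
    have "f (- y u v) \<le> - Re (u + v * z)" by (rule order_trans[OF f(2) q(3)[OF C]])
    then show "Re (u + v * z) \<le> f (y u v)" by (simp add: neg)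
  qed
  define \<phi> where "\<phi> x = Complex (f x) (- f (\<i> *\<^sub>C x))" for x
  have dec: "c *\<^sub>C x = Re c *\<^sub>R x + Im c *\<^sub>R (\<i> *\<^sub>C x)" for c x
    by (metis complex_eq scaleC_add_left scaleC_of_real scaleR_scaleC mult.commute)
  have fc: "f (c *\<^sub>C x) = Re c * f x + Im c * f (\<i> *\<^sub>C x)" for c x
    by (simp add: dec[of c] add scale)
  have scale': "\<phi> (c *\<^sub>C x) = c * \<phi> x" for c x
    using fc[of c x] fc[of "\<i> * c" x]
    by (simp add: \<phi>_def complex_eq_iff scaleC_scaleC algebra_simps)
  have bound: "cmod (\<phi> x) \<le> norm x" for x
  proof -
    obtain w where w: "cmod w = 1" "w * \<phi> x = of_real (cmod (\<phi> x))"
      using exists_unit_rotation by blast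
    have "cmod (\<phi> x) = Re (\<phi> (w *\<^sub>C x))" by (simp add: scale' w)
    also have "\<dots> = f (w *\<^sub>C x)" by (simp add: \<phi>_def)
    also have "\<dots> \<le> norm (w *\<^sub>C x)" by (rule order_trans[OF f(2) q(2)])
    finally show ?thesis by (simp add: norm_scaleC w)
  qed
  have "\<phi> \<in> states"
  proof (rule unital_contraction_is_state)
    show "\<phi> 1 = 1" using fy[of 1 0] fy[of \<i> 0] by (simp add: \<phi>_def y_def complex_eq_iff)
  qed (simp_all add: \<phi>_def add scaleC_add_right complex_eq_iff scale'[unfolded \<phi>_def] bound[unfolded \<phi>_def])
  moreover have "\<phi> a = z"
    using fy[of 0 1] fy[of 0 \<i>] by (simp add: \<phi>_def y_def complex_eq_iff)
  ultimately show "z \<in> numerical_range a" by (auto simp: numerical_range_def)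
qed

corollary spectrum_subset_numerical_range: "spectrum a \<subseteq> numerical_range a"
  by (auto simp: numerical_range_iff spectrum_le_norm_shift)

lemma state_attaining_norm_positive:
  assumes "positive p"
  obtains \<phi> where "\<phi> \<in> states" "\<phi> p = of_real (norm p)"
proof -
  have "of_real (norm p) \<in> spectrum p"
  proof -
    have "\<not> invertible_elt (p - norm p *\<^sub>R 1)"
      using norm_minus_positive_not_invertible[OF assms] invertible_elt_scaleR[of "-1" "p - norm p *\<^sub>R 1"] by auto
    then show ?thesis by (simp add: spectrum_iff scaleC_of_real)
  qed
  then have "of_real (norm p) \<in> numerical_range p" using spectrum_subset_numerical_range by blast
  with that show ?thesis by (auto simp: numerical_range_def)
qed

section \<open>Roberts orthogonality to the unit\<close>

lemma roberts_imp_numerical_range_symmetric: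
  assumes "a \<bottom>\<^sub>R 1"
  shows "numerical_range a = uminus ` numerical_range a"
proof -
  have sub: "- z \<in> numerical_range a" if "z \<in> numerical_range a" for z
    unfolding numerical_range_iff
  proof
    fix c
    have "cmod (- z + c) = cmod (z + - c)" by (metis norm_minus_cancel minus_add_distrib minus_minus)
    also have "\<dots> \<le> norm (a + (- c) *\<^sub>C 1)" using that unfolding numerical_range_iff by blast
    also have "\<dots> = norm (a + c *\<^sub>C 1)" using assms by (simp add: roberts_orthogonal_def)
    finally show "cmod (- z + c) \<le> norm (a + c *\<^sub>C 1)" .
  qed
  then show ?thesis by (force simp: image_iff intro: bexI[of _ "- _"])
qed

lemma roberts_orthogonalI:
  assumes "\<And>c. norm (x + c *\<^sub>C y) \<le> norm (x - c *\<^sub>C y)"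
  shows "x \<bottom>\<^sub>R y"
  unfolding roberts_orthogonal_def
  using assms assms[of "- _"] by (auto intro!: antisym)

lemma symmetric_numerical_range_state:
  assumes "numerical_range a = uminus ` numerical_range a" "\<phi> \<in> states"
  obtains \<psi> where "\<psi> \<in> states" "\<psi> a = - \<phi> a"
proof -
  have "\<phi> a \<in> numerical_range a" using assms(2) by (auto simp: numerical_range_def)
  then have "- \<phi> a \<in> numerical_range a" by (subst assms(1)) simp
  with that show ?thesis by (force simp: numerical_range_def)
qed

text \<open>Choose a state \<open>\<phi>\<close> that attains the norm of \<open>(a + c)\<^sup>*(a + c)\<close>, and a state \<open>\<psi>\<close> with
  \<open>\<psi> a = - \<phi> a\<close>; it takes the same value at \<open>(a - c)\<^sup>*(a - c)\<close>.\<close>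

lemma isometry_roberts:
  fixes a :: "'a::unital_cstar_algebra"
  assumes iso: "star a * a = 1" and sym: "numerical_range a = uminus ` numerical_range a"
  shows "a \<bottom>\<^sub>R 1"
proof (rule roberts_orthogonalI)
  fix c
  let ?p = "\<lambda>c. star (a + c *\<^sub>C 1) * (a + c *\<^sub>C 1)"
  have val: "Re (\<phi> (?p c)) = 1 + (cmod c)\<^sup>2 + 2 * Re (cnj c * \<phi> a)" if "\<phi> \<in> states" for \<phi> c
  proof -
    have "?p c = 1 + c *\<^sub>C star a + cnj c *\<^sub>C a + (cnj c * c) *\<^sub>C 1"
      by (simp add: star_add star_scaleC algebra_simps scaleC_simps iso)
    then have "\<phi> (?p c) = 1 + c * cnj (\<phi> a) + cnj c * \<phi> a + cnj c * c"
      by (simp add: state_add[OF that] state_scaleC[OF that] state_star[OF that] state_one[OF that])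
    then show ?thesis by (simp add: cmod_power2) (simp add: power2_eq_square algebra_simps)
  qed
  obtain \<phi> where \<phi>: "\<phi> \<in> states" "\<phi> (?p c) = of_real (norm (?p c))"
    using state_attaining_norm_positive[OF positive_star_square] .
  obtain \<psi> where \<psi>: "\<psi> \<in> states" "\<psi> a = - \<phi> a"
    using symmetric_numerical_range_state[OF sym \<phi>(1)] .
  have "(norm (a + c *\<^sub>C 1))\<^sup>2 = Re (\<phi> (?p c))" by (simp add: \<phi>(2) cstar_identity)
  also have "\<dots> = Re (\<psi> (?p (- c)))" unfolding val[OF \<phi>(1)] val[OF \<psi>(1)] by (simp add: \<psi>(2))
  also have "\<dots> \<le> norm (?p (- c))"
    by (rule order_trans[OF complex_Re_le_cmod state_norm_le[OF \<psi>(1)]])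
  also have "\<dots> = (norm (a - c *\<^sub>C 1))\<^sup>2" using cstar_identity[of "a - c *\<^sub>C 1"] by simp
  finally show "norm (a + c *\<^sub>C 1) \<le> norm (a - c *\<^sub>C 1)" by (rule power2_le_imp_le) simp
qed

text \<open>This is \<open>w(b\<^sup>2) \<le> w(b)\<^sup>2\<close> for the numerical radius \<open>w\<close>, the supremum of the norms of the real parts
  of all rotations of \<open>b\<close>. The real part of a square \<open>(h + i k)\<^sup>2\<close> is \<open>h\<^sup>2 - k\<^sup>2\<close>, and both squares lie
  between \<open>0\<close> and \<open>w\<^sup>2\<close>.\<close>

lemma norm_re_part_square_le:
  fixes b :: "'a::unital_cstar_algebra"
  assumes "\<And>u. cmod u = 1 \<Longrightarrow> norm (re_part (u *\<^sub>C b)) \<le> w" "cmod u = 1"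
  shows "norm (re_part (u *\<^sub>C (b * b))) \<le> w\<^sup>2"
proof -
  \<comment> \<open>Splitting the rotation evenly makes \<open>u b\<^sup>2\<close> the square of the rotation \<open>v b\<close>.\<close>
  define v where "v = csqrt u"
  have vv: "v * v = u" by (simp add: v_def flip: power2_eq_square)
  then have v: "cmod v = 1" using assms(2) norm_mult[of v v] by (metis norm_ge_zero real_sqrt_abs2 abs_of_nonneg real_sqrt_one)
  define h k where "h = re_part (v *\<^sub>C b)" and "k = re_part (- \<i> *\<^sub>C (v *\<^sub>C b))"
  have hk: "norm h \<le> w" "norm k \<le> w"
    using assms(1)[of v] assms(1)[of "- \<i> * v"] v by (simp_all add: h_def k_def scaleC_scaleC norm_mult)
  have sq: "norm ((w\<^sup>2/2) *\<^sub>R 1 - x * x) \<le> w\<^sup>2/2" if "star x = x" "norm x \<le> w" for x :: 'a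
    using that by (intro norm_real_minus_square) (simp_all add: power_mono)
  have "u *\<^sub>C (b * b) = (v *\<^sub>C b) * (v *\<^sub>C b)" by (simp add: scaleC_simps vv)
  then have "re_part (u *\<^sub>C (b * b)) = h * h - k * k" by (simp only: re_part_square h_def k_def)
  \<comment> \<open>Centring both squares at \<open>w\<^sup>2/2\<close> keeps the triangle inequality from losing a factor \<open>2\<close>.\<close>
  also have "\<dots> = ((w\<^sup>2/2) *\<^sub>R 1 - k * k) - ((w\<^sup>2/2) *\<^sub>R 1 - h * h)" by simp
  also have "norm \<dots> \<le> w\<^sup>2/2 + w\<^sup>2/2"
    using hk by (intro norm_triangle_le_diff add_mono sq) (simp_all add: h_def k_def)
  finally show ?thesis by simp
qed

lemma norm_normal_power:
  fixes b :: "'a::unital_cstar_algebra"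
  assumes "star b * b = b * star b"
  shows "norm (b * b) = (norm b)\<^sup>2" "star (b * b) * (b * b) = (b * b) * star (b * b)"
proof -
  have e: "star (b * b) * (b * b) = (star b * b) * (star b * b)"
  proof -
    have "star (b * b) * (b * b) = star b * (star b * b) * b" by (simp only: star_mult mult.assoc)
    also have "\<dots> = star b * (b * star b) * b" by (simp only: assms)
    also have "\<dots> = (star b * b) * (star b * b)" by (simp only: mult.assoc)
    finally show ?thesis .
  qed
  have "(norm (b * b))\<^sup>2 = (norm (star b * b))\<^sup>2"
    using cstar_identity[of "b * b"] norm_square_selfadjoint[of "star b * b"]
    unfolding e by (simp add: star_mult star_star)
  then have "norm (b * b) = norm (star b * b)" by (rule power2_eq_imp_eq) simp_all
  then show "norm (b * b) = (norm b)\<^sup>2" by (simp only: cstar_identity)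
  have "(b * b) * star (b * b) = b * (b * star b) * star b" by (simp only: star_mult mult.assoc)
  also have "\<dots> = (star b * b) * (star b * b)" 
  proof -
    have "b * (b * star b) * star b = b * (star b * b) * star b" by (simp only: assms)
    also have "\<dots> = (b * star b) * (b * star b)" by (simp only: mult.assoc)
    finally show ?thesis by (simp only: assms)
  qed
  finally show "star (b * b) * (b * b) = (b * b) * star (b * b)" using e by simp
qed

text \<open>Squaring \<open>n\<close> times turns \<open>\<parallel>b\<parallel> \<le> 2 w\<close> into a bound on the \<open>2^n\<close>-th power of \<open>\<parallel>b\<parallel> / w\<close> by the
  constant \<open>2\<close>, which is impossible for large \<open>n\<close> unless \<open>\<parallel>b\<parallel> \<le> w\<close>.\<close>

lemma normal_norm_le_numerical_radius:
  fixes b :: "'a::unital_cstar_algebra"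
  assumes normal: "star b * b = b * star b"
    and bound: "\<And>u. cmod u = 1 \<Longrightarrow> norm (re_part (u *\<^sub>C b)) \<le> w"
  shows "norm b \<le> w"
proof -
  have w0: "0 \<le> w" by (rule order_trans[OF norm_ge_zero bound[of 1]]) simp
  have main: "norm b ^ (2 ^ n) \<le> 2 * w ^ (2 ^ n)"
    if "star b * b = b * star b" "\<And>u. cmod u = 1 \<Longrightarrow> norm (re_part (u *\<^sub>C b)) \<le> w"
    for n w and b :: 'a
    using that
  proof (induction n arbitrary: b w)
    case 0
    have "norm b \<le> norm (re_part b) + norm (\<i> *\<^sub>C re_part (- \<i> *\<^sub>C b))"
      using re_im_decomposition[of b] norm_triangle_ineq by metis
    also have "\<dots> \<le> w + w"
      using "0.prems"(2)[of 1] "0.prems"(2)[of "- \<i>"] by (simp add: norm_scaleC)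
    finally show ?case by simp
  next
    case (Suc n)
    have "norm (b * b) ^ (2 ^ n) \<le> 2 * (w\<^sup>2) ^ (2 ^ n)"
      using Suc.prems norm_re_part_square_le[of b w] by (intro Suc.IH norm_normal_power) blast+
    then show ?case
      using Suc.prems(1) by (simp add: norm_normal_power power_mult[symmetric])
  qed
  show ?thesis
  proof (rule ccontr)
    assume "\<not> ?thesis"
    then have lt: "w < norm b" by simp
    show False
    proof (cases "w = 0")
      case True
      with main[OF normal bound, of 0] lt show False by simp
    next
      case False
      with w0 have w: "0 < w" by simp
      obtain n where n: "2 < (norm b / w) ^ n"
        using real_arch_pow[of "norm b / w" 2] lt w by auto
      have "(norm b / w) ^ n \<le> (norm b / w) ^ (2 ^ n)"
        using lt w by (intro power_increasing) (simp_all add: less_imp_le)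
      also have "\<dots> \<le> 2"
        using main[OF normal bound, of n] w by (simp add: power_divide field_simps)
      finally show False using n by simp
    qed
  qed
qed

text \<open>The norm of each real part of a rotation of \<open>a + c\<close> is attained by a state \<open>\<phi>\<close>, up to sign, and
  \<open>|\<phi> a + c| = |\<psi> a - c| \<le> \<parallel>a - c\<parallel>\<close> for a state \<open>\<psi>\<close> with \<open>\<psi> a = - \<phi> a\<close>.\<close>

lemma normal_roberts:
  fixes a :: "'a::unital_cstar_algebra"
  assumes normal: "star a * a = a * star a"
    and sym: "numerical_range a = uminus ` numerical_range a"
  shows "a \<bottom>\<^sub>R 1"
proof (rule roberts_orthogonalI)
  fix c
  let ?b = "a + c *\<^sub>C 1"
  show "norm ?b \<le> norm (a - c *\<^sub>C 1)"
  proof (rule normal_norm_le_numerical_radius)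
    show "star ?b * ?b = ?b * star ?b"
      using normal by (simp add: star_add star_scaleC algebra_simps scaleC_simps mult.commute)
    fix u :: complex assume u: "cmod u = 1"
    let ?h = "re_part (u *\<^sub>C ?b)"
    obtain z where "z \<in> spectrum ?h" "cmod z = norm ?h"
      using selfadjoint_norm_in_spectrum[of ?h] by force
    then obtain \<phi> where \<phi>: "\<phi> \<in> states" "cmod (\<phi> ?h) = norm ?h"
      using spectrum_subset_numerical_range by (force simp: numerical_range_def)
    obtain \<psi> where \<psi>: "\<psi> \<in> states" "\<psi> a = - \<phi> a"
      using symmetric_numerical_range_state[OF sym \<phi>(1)] .
    have "\<phi> ?h = of_real (Re (u * (\<phi> a + c)))"
      by (simp only: state_re_part[OF \<phi>(1)] state_scaleC[OF \<phi>(1)] state_shift[OF \<phi>(1)])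
    then have "norm ?h = \<bar>Re (u * (\<phi> a + c))\<bar>"
      using \<phi>(2) by (simp only: norm_of_real)
    also have "\<dots> \<le> cmod (\<phi> a + c)" using abs_Re_le_cmod[of "u * (\<phi> a + c)"] u by (simp add: norm_mult)
    also have "\<dots> = cmod (\<psi> a + - c)" by (metis \<psi>(2) norm_minus_cancel minus_add_distrib)
    also have "\<dots> \<le> norm (a + (- c) *\<^sub>C 1)"
      using state_norm_le[OF \<psi>(1), of "a + (- c) *\<^sub>C 1"] unfolding state_shift[OF \<psi>(1)] .
    finally show "norm ?h \<le> norm (a - c *\<^sub>C 1)" by simp
  qed
qed

text \<open>One of \<open>\<plusminus>\<parallel>a\<parallel>\<close> is in the spectrum. After replacing \<open>a\<close> by \<open>-a\<close> if necessary it is \<open>\<parallel>a\<parallel>\<close>, and then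
  \<open>q = \<parallel>a\<parallel> - a\<close> is positive of norm \<open>2\<parallel>a\<parallel>\<close>, with \<open>\<parallel>q\<parallel> - q = a + \<parallel>a\<parallel>\<close> not invertible.\<close>

lemma selfadjoint_roberts_spectrum:
  fixes a :: "'a::unital_cstar_algebra"
  assumes sa: "star a = a" and r: "a \<bottom>\<^sub>R 1"
  shows "complex_of_real (norm a) \<in> spectrum a" "complex_of_real (- norm a) \<in> spectrum a"
proof -
  have key: "complex_of_real (- norm b) \<in> spectrum b"
    if sb: "star b = b" and r: "\<And>c. norm (b + c *\<^sub>C 1) = norm (b - c *\<^sub>C 1)"
      and s: "complex_of_real (norm b) \<in> spectrum b" for b :: 'a
  proof -
    define q where "q = norm b *\<^sub>R 1 - b"
    have q: "positive q" unfolding q_def by (rule positive_real_minus[OF sb]) simp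
    have "2 * norm b = cmod (of_real (norm b) + of_real (norm b))"
      by (simp only: of_real_add[symmetric] norm_of_real) simp
    also have "\<dots> \<le> norm (b + of_real (norm b) *\<^sub>C 1)" by (rule spectrum_le_norm_shift[OF s])
    also have "\<dots> = norm q" unfolding r q_def by (simp add: scaleC_of_real norm_minus_commute)
    finally have "2 * norm b \<le> norm q" .
    moreover have "norm q \<le> 2 * norm b"
      using norm_triangle_ineq4[of "norm b *\<^sub>R 1" b] by (simp add: q_def)
    ultimately have nq: "norm q = 2 * norm b" by simp
    have "norm q *\<^sub>R 1 - q = b - of_real (- norm b) *\<^sub>C 1"
      unfolding nq mult_2 scaleR_add_left by (simp add: q_def scaleC_of_real)
    then show ?thesis
      using norm_minus_positive_not_invertible[OF q] by (simp only: spectrum_iff not_False_eq_True)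
  qed
  have r1: "norm (a + c *\<^sub>C 1) = norm (a - c *\<^sub>C 1)" for c
    using r by (simp add: roberts_orthogonal_def)
  have r2: "norm (- a + c *\<^sub>C 1) = norm (- a - c *\<^sub>C 1)" for c
  proof -
    have "- a + c *\<^sub>C 1 = - (a - c *\<^sub>C 1)" "- a - c *\<^sub>C 1 = - (a + c *\<^sub>C 1)" by simp_all
    then show ?thesis by (simp only: norm_minus_cancel r1)
  qed
  have neg: "z \<in> spectrum a \<longleftrightarrow> - z \<in> spectrum (- a)" for z
  proof -
    have "- a - (- z) *\<^sub>C 1 = (-1) *\<^sub>R (a - z *\<^sub>C 1)"
      "a - z *\<^sub>C 1 = (-1) *\<^sub>R (- a - (- z) *\<^sub>C 1)" by simp_all
    then show ?thesis
      unfolding spectrum_iff using invertible_elt_scaleR[of "-1"] by (metis zero_neq_neg_one)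
  qed
  have "complex_of_real (norm a) \<in> spectrum a \<and> complex_of_real (- norm a) \<in> spectrum a"
  proof (cases "complex_of_real (norm a) \<in> spectrum a")
    case True
    with key[OF sa r1] show ?thesis by blast
  next
    case False
    with selfadjoint_norm_in_spectrum[OF sa] have m: "complex_of_real (- norm a) \<in> spectrum a" by blast
    then have "complex_of_real (norm (- a)) \<in> spectrum (- a)" using neg[of "of_real (- norm a)"] by simp
    then have "complex_of_real (- norm (- a)) \<in> spectrum (- a)" 
      by (rule key[OF _ r2, rotated]) (simp add: sa)
    then have "complex_of_real (norm a) \<in> spectrum a" using neg[of "of_real (norm a)"] by simp
    with m show ?thesis by blast
  qed
  then show "complex_of_real (norm a) \<in> spectrum a" "complex_of_real (- norm a) \<in> spectrum a"
    by auto
qed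

text \<open>Above, \<open>\<parallel>a + c\<parallel>\<^sup>2 = \<parallel>(a + Re c)\<^sup>2 + (Im c)\<^sup>2\<parallel>\<close> is bounded by the triangle inequality. Below,
  the spectral value \<open>\<plusminus>\<parallel>a\<parallel>\<close> with the sign of \<open>Re c\<close> is used.\<close>

lemma norm_selfadjoint_shift:
  fixes a :: "'a::unital_cstar_algebra"
  assumes sa: "star a = a"
    and s: "complex_of_real (norm a) \<in> spectrum a" "complex_of_real (- norm a) \<in> spectrum a"
  shows "(norm (a + c *\<^sub>C 1))\<^sup>2 = (norm a + \<bar>Re c\<bar>)\<^sup>2 + (Im c)\<^sup>2"
proof (rule antisym)
  let ?h = "a + Re c *\<^sub>R 1"
  have x: "a + c *\<^sub>C 1 = ?h + (\<i> * of_real (Im c)) *\<^sub>C 1"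
  proof -
    have "c *\<^sub>C (1::'a) = (of_real (Re c) + \<i> * of_real (Im c)) *\<^sub>C 1"
      by (simp only: complex_eq[symmetric])
    then show ?thesis by (simp only: scaleC_add_left scaleC_of_real add.assoc)
  qed
  have sx: "star (a + c *\<^sub>C 1) = ?h - (\<i> * of_real (Im c)) *\<^sub>C 1"
    unfolding x using sa by (simp add: star_add star_scaleC)
  have "star (a + c *\<^sub>C 1) * (a + c *\<^sub>C 1) = ?h * ?h + of_real (Im c * Im c) *\<^sub>C 1"
    unfolding sx unfolding x by (simp add: algebra_simps scaleC_simps scaleC_scaleR scaleR_scaleC)
  then have "(norm (a + c *\<^sub>C 1))\<^sup>2 = norm (?h * ?h + (Im c)\<^sup>2 *\<^sub>R 1)"
    using cstar_identity[of "a + c *\<^sub>C 1"] by (simp only: scaleC_of_real power2_eq_square)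
  also have "\<dots> \<le> (norm ?h)\<^sup>2 + (Im c)\<^sup>2"
    using norm_triangle_ineq[of "?h * ?h" "(Im c)\<^sup>2 *\<^sub>R 1"] norm_square_selfadjoint[of ?h] sa
    by (simp add: star_add)
  also have "\<dots> \<le> (norm a + \<bar>Re c\<bar>)\<^sup>2 + (Im c)\<^sup>2"
    using norm_triangle_ineq[of a "Re c *\<^sub>R 1"] by (intro add_right_mono power_mono) simp_all
  finally show "(norm (a + c *\<^sub>C 1))\<^sup>2 \<le> (norm a + \<bar>Re c\<bar>)\<^sup>2 + (Im c)\<^sup>2" .
  have "(cmod (of_real (norm a) + c))\<^sup>2 \<le> (norm (a + c *\<^sub>C 1))\<^sup>2"
    "(cmod (of_real (- norm a) + c))\<^sup>2 \<le> (norm (a + c *\<^sub>C 1))\<^sup>2"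
    by (rule power_mono[OF spectrum_le_norm_shift[OF s(1)] norm_ge_zero],
      rule power_mono[OF spectrum_le_norm_shift[OF s(2)] norm_ge_zero])
  then have "(norm a + Re c)\<^sup>2 + (Im c)\<^sup>2 \<le> (norm (a + c *\<^sub>C 1))\<^sup>2"
    "(- norm a + Re c)\<^sup>2 + (Im c)\<^sup>2 \<le> (norm (a + c *\<^sub>C 1))\<^sup>2"
    by (simp_all only: cmod_power2 plus_complex.sel Re_complex_of_real Im_complex_of_real add_0_left)
  moreover have "(- norm a + Re c)\<^sup>2 = (norm a - Re c)\<^sup>2" by (simp add: power2_eq_square algebra_simps)
  ultimately show "(norm a + \<bar>Re c\<bar>)\<^sup>2 + (Im c)\<^sup>2 \<le> (norm (a + c *\<^sub>C 1))\<^sup>2"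
    by (cases "0 \<le> Re c") (simp_all only: abs_of_nonneg abs_of_neg not_le diff_conv_add_uminus)
qed

lemma selfadjoint_spectrum_roberts:
  fixes a :: "'a::unital_cstar_algebra"
  assumes "star a = a"
    and "complex_of_real (norm a) \<in> spectrum a" "complex_of_real (- norm a) \<in> spectrum a"
  shows "a \<bottom>\<^sub>R 1"
proof (rule roberts_orthogonalI)
  fix c
  have "(norm (a + c *\<^sub>C 1))\<^sup>2 = (norm (a + (- c) *\<^sub>C 1))\<^sup>2"
    unfolding norm_selfadjoint_shift[OF assms] by simp
  then have "norm (a + c *\<^sub>C 1) = norm (a + (- c) *\<^sub>C 1)"
    by (rule power2_eq_imp_eq) simp_all
  then show "norm (a + c *\<^sub>C 1) \<le> norm (a - c *\<^sub>C 1)" by simp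
qed

theorem proposition2p5:
  fixes a :: "'a::unital_cstar_algebra"
  shows "(star a * a = 1 \<longrightarrow>
            (a \<bottom>\<^sub>R 1 \<longleftrightarrow> numerical_range a = uminus ` numerical_range a)) \<and>
         (star a * a = a * star a \<longrightarrow>
            (a \<bottom>\<^sub>R 1 \<longleftrightarrow> numerical_range a = uminus ` numerical_range a)) \<and>
         (star a = a \<longrightarrow>
            (a \<bottom>\<^sub>R 1 \<longleftrightarrow>
              complex_of_real (norm a) \<in> spectrum a \<and> complex_of_real (- norm a) \<in> spectrum a))"
proof (intro conjI impI iffI)
  assume "a \<bottom>\<^sub>R 1"
  then show "numerical_range a = uminus ` numerical_range a"
    by (rule roberts_imp_numerical_range_symmetric)
  then show "numerical_range a = uminus ` numerical_range a" .
next
  assume "star a * a = 1" "numerical_range a = uminus ` numerical_range a"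
  then show "a \<bottom>\<^sub>R 1" by (rule isometry_roberts)
next
  assume "star a * a = a * star a" "numerical_range a = uminus ` numerical_range a"
  then show "a \<bottom>\<^sub>R 1" by (rule normal_roberts)
next
  assume "star a = a" "a \<bottom>\<^sub>R 1"
  then show "complex_of_real (norm a) \<in> spectrum a" "complex_of_real (- norm a) \<in> spectrum a"
    by (rule selfadjoint_roberts_spectrum)+
next
  assume "star a = a"
    "complex_of_real (norm a) \<in> spectrum a \<and> complex_of_real (- norm a) \<in> spectrum a"
  then show "a \<bottom>\<^sub>R 1" by (intro selfadjoint_spectrum_roberts) simp_all
qed

end
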